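(* Let $\Omega\subseteq\mathbb{R}^n$ be open. An element $\widetilde R\in\mathcal{G}^e(\Omega)$ is invertible in $\mathcal{G}^e(\Omega)$ if and only if $\widetilde R(\widetilde X)$ is invertible in $\widetilde{\mathbb{C}}(n)$ for each $\widetilde X\in\widetilde\Omega_c(n)$.
   Context: Notation. $n\in\mathbb{N}=\{1,2,\dots\}$, $\mathbb{N}_0=\mathbb{N}\cup\{0\}$, $\Omega\subseteq\mathbb{R}^n$ open. $K\subset\subset\Omega$ means $K$ is a compact subset of $\Omega$. For expressions defined for small $\varepsilon>0$, $f(\varepsilon)=O(g(\varepsilon))$ means $\exists C>0\ \exists\varepsilon_0>0\ \forall\varepsilon<\varepsilon_0$: $|f(\varepsilon)|<C|g(\varepsilon)|$. $\mathcal{D}(\mathbb{R}^n)$ is the space of smooth compactly supported (complex-valued) functions. For $q\in\mathbb{N}_0$, $\mathcal{A}_q(\mathbb{R}^n)$ is the set of $\varphi\in\mathcal{D}(\mathbb{R}^n)$ with $\int\varphi=1$ and $\int x^\alpha\varphi(x)\,dx=0$ for all multi-indices $\alpha$ with $1\le|\alpha|\le q$. For $\varepsilon>0$, $(S_\varepsilon\varphi)(y):=\varepsilon^{-n}\varphi(y/\varepsilon)$. $U(\Omega):=\{(\varphi,x)\in\mathcal{A}_0(\mathbb{R}^n)\times\Omega: \operatorname{supp}\varphi+x\subseteq\Omega\}$. The algebra $\mathcal{G}^e(\Omega)$. $\mathcal{E}^e(\Omega)$ is the set of functions $R:U(\Omega)\to\mathbb{C}$ that are smooth in the second variable $x$;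 $\partial^\alpha$ denotes derivatives with respect to $x$. $R$ is moderate ($R\in\mathcal{E}^e_M(\Omega)$) if $\forall K\subset\subset\Omega\ \forall\alpha\in\mathbb{N}_0^n\ \exists N\in\mathbb{N}\ \forall\varphi\in\mathcal{A}_N(\mathbb{R}^n)$: $\sup_{x\in K}|\partial^\alpha R(S_\varepsilon\varphi,x)|=O(\varepsilon^{-N})$. $R$ is negligible ($R\in\mathcal{N}^e(\Omega)$) if $\forall K\subset\subset\Omega\ \forall\alpha\in\mathbb{N}_0^n\ \forall m\in\mathbb{N}\ \exists q\in\mathbb{N}\ \forall\varphi\in\mathcal{A}_q(\mathbb{R}^n)$: $\sup_{x\in K}|\partial^\alpha R(S_\varepsilon\varphi,x)|=O(\varepsilon^{m})$. $\mathcal{G}^e(\Omega):=\mathcal{E}^e_M(\Omega)/\mathcal{N}^e(\Omega)$ with pointwise operations. Generalized numbers. $\mathbb{C}_M(n)$ is the set of $r:\mathcal{A}_0(\mathbb{R}^n)\to\mathbb{C}$ such that $\exists N\in\mathbb{N}\ \forall\varphi\in\mathcal{A}_N(\mathbb{R}^n)$: $|r(S_\varepsilon\varphi)|=O(\varepsilon^{-N})$; $\mathbb{C}_N(n)$ is the set of $r:\mathcal{A}_0(\mathbb{R}^n)\to\mathbb{C}$ such that $\forall m\in\mathbb{N}\ \exists q\in\mathbb{N}\ \forall\varphi\in\mathcal{A}_q(\mathbb{R}^n)$: $|r(S_\varepsilon\varphi)|=O(\varepsilon^m)$; $\widetilde{\mathbb{C}}(n):=\mathbb{C}_M(n)/\mathbb{C}_N(n)$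 with pointwise operations. Generalized points. $\Omega_M(n)$ is the set of maps $X:\mathcal{A}_0(\mathbb{R}^n)\to\Omega$ such that (a) $\forall\varphi\in\mathcal{A}_0(\mathbb{R}^n)\ \exists\varepsilon_0>0\ \forall\varepsilon<\varepsilon_0$: $(S_\varepsilon\varphi,X(S_\varepsilon\varphi))\in U(\Omega)$, and (b) $\exists N\in\mathbb{N}\ \forall\varphi\in\mathcal{A}_N(\mathbb{R}^n)$: $|X(S_\varepsilon\varphi)|=O(\varepsilon^{-N})$. For $X,Y\in\Omega_M(n)$, $X\sim Y$ means $\forall m\in\mathbb{N}\ \exists q\in\mathbb{N}\ \forall\varphi\in\mathcal{A}_q(\mathbb{R}^n)$: $|X(S_\varepsilon\varphi)-Y(S_\varepsilon\varphi)|=O(\varepsilon^m)$. $\widetilde\Omega(n):=\Omega_M(n)/\sim$. $X\in\Omega_M(n)$ is compactly supported if $\exists K\subset\subset\Omega\ \exists N\in\mathbb{N}\ \forall\varphi\in\mathcal{A}_N(\mathbb{R}^n)\ \exists\eta>0\ \forall\varepsilon<\eta$: $X(S_\varepsilon\varphi)\in K$. $\widetilde\Omega_c(n)$ is the set of classes in $\widetilde\Omega(n)$ having one (equivalently, only) compactly supported representative(s). Point values. For $R\in\mathcal{E}^e_M(\Omega)$ and compactly supported $X\in\Omega_M(n)$, $R(X):\mathcal{A}_0(\mathbb{R}^n)\to\mathbb{C}$ is given by $R(X)(\varphi):=R(\varphi,X(\varphi))$ if $(\varphi,X(\varphi))\in U(\Omega)$ and $R(X)(\varphi):=0$ otherwise.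 For $\widetilde R=[R]\in\mathcal{G}^e(\Omega)$ and $\widetilde X=[X]\in\widetilde\Omega_c(n)$, the point value $\widetilde R(\widetilde X)\in\widetilde{\mathbb{C}}(n)$ is the class of $R(X)$ (this is well defined). *)

theory Defs
  imports "HOL-Analysis.Analysis" "HOL-Library.Landau_Symbols" "HOL-Algebra.QuotRing"
begin

definition partial_deriv ::
  "'n::finite \<Rightarrow> (real^'n \<Rightarrow> complex) \<Rightarrow> real^'n \<Rightarrow> complex" where
  "partial_deriv i f x = vector_derivative (\<lambda>t. f (x + t *\<^sub>R axis i 1)) (at 0)"

definition smooth_on :: "(real^'n::finite) set \<Rightarrow> (real^'n \<Rightarrow> complex) \<Rightarrow> bool" where
  "smooth_on S f \<longleftrightarrow> (\<forall>is. fold partial_deriv is f differentiable_on S)"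
  \<comment> \<open>Only used for open \<open>S\<close>, where the values of \<open>f\<close> outside \<open>S\<close> do not matter. All
      iterated partial derivatives, in any order, are differentiable, hence continuous.\<close>

type_synonym 'n multi_index = "'n \<Rightarrow> nat"

definition mi_order :: "'n::finite multi_index \<Rightarrow> nat" where
  "mi_order \<alpha> = (\<Sum>i\<in>UNIV. \<alpha> i)"

definition mi_power :: "real^'n::finite \<Rightarrow> 'n multi_index \<Rightarrow> real" where
  "mi_power x \<alpha> = (\<Prod>i\<in>UNIV. (x $ i) ^ \<alpha> i)"

text \<open>The index type carries no order, so an enumeration of the coordinates is fixed
  arbitrarily; by Schwarz's theorem it does not affect \<open>mi_deriv \<alpha> f\<close> for smooth \<open>f\<close>.\<close>

definition coords :: "'n::finite list" where
  "coords = (SOME is. distinct is \<and> set is = UNIV)"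

definition mi_deriv ::
  "'n::finite multi_index \<Rightarrow> (real^'n \<Rightarrow> complex) \<Rightarrow> real^'n \<Rightarrow> complex" where
  "mi_deriv \<alpha> f = fold (\<lambda>i. partial_deriv i ^^ \<alpha> i) coords f"

text \<open>The case distinction is needed because \<open>Sup {}\<close> is unspecified on the reals.\<close>

definition sup_norm_on :: "(real^'n::finite) set \<Rightarrow> (real^'n \<Rightarrow> complex) \<Rightarrow> real" where
  "sup_norm_on K f = (if K = {} then 0 else (SUP x\<in>K. cmod (f x)))"

definition supp :: "(real^'n::finite \<Rightarrow> complex) \<Rightarrow> (real^'n) set" where
  "supp \<phi> = closure {x. \<phi> x \<noteq> 0}"

definition test_functions :: "(real^'n::finite \<Rightarrow> complex) set" where
  "test_functions = {\<phi>. smooth_on UNIV \<phi> \<and> compact (supp \<phi>)}"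

definition moment_functions :: "nat \<Rightarrow> (real^'n::finite \<Rightarrow> complex) set" (\<open>\<A>\<close>) where
  "\<A> q = {\<phi> \<in> test_functions. (LINT x|lborel. \<phi> x) = 1 \<and>
     (\<forall>\<alpha>. 1 \<le> mi_order \<alpha> \<and> mi_order \<alpha> \<le> q \<longrightarrow>
        (LINT x|lborel. of_real (mi_power x \<alpha>) * \<phi> x) = 0)}"

definition scale :: "real \<Rightarrow> (real^'n::finite \<Rightarrow> complex) \<Rightarrow> real^'n \<Rightarrow> complex" where
  "scale \<epsilon> \<phi> y = of_real (1 / \<epsilon> ^ CARD('n)) * \<phi> ((1 / \<epsilon>) *\<^sub>R y)"

definition U_set ::
  "(real^'n::finite) set \<Rightarrow> ((real^'n \<Rightarrow> complex) \<times> (real^'n)) set" where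
  "U_set \<Omega> = {(\<phi>, x). \<phi> \<in> \<A> 0 \<and> x \<in> \<Omega> \<and> (\<lambda>y. y + x) ` supp \<phi> \<subseteq> \<Omega>}"

text \<open>Functions with a restricted domain are represented as extensional functions, so that
  they are determined by their values on that domain. Ring operations are pointwise
  on the domain \<open>D\<close>.\<close>

definition pointwise_ring :: "'a set \<Rightarrow> ('a \<Rightarrow> complex) set \<Rightarrow> ('a \<Rightarrow> complex) ring" where
  "pointwise_ring D F =
     \<lparr>carrier = F, mult = (\<lambda>f g. \<lambda>p\<in>D. f p * g p), one = (\<lambda>p\<in>D. 1),
      zero = (\<lambda>p\<in>D. 0), add = (\<lambda>f g. \<lambda>p\<in>D. f p + g p)\<rparr>"

type_synonym 'n gfun = "(real^'n \<Rightarrow> complex) \<times> (real^'n) \<Rightarrow> complex"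

text \<open>For open \<open>\<Omega>\<close> the slices \<open>{x. (\<phi>, x) \<in> U_set \<Omega>}\<close> are open, and a compact
  \<open>K \<subseteq> \<Omega>\<close> lies in the slice of \<open>scale \<epsilon> \<phi>\<close> for all small \<open>\<epsilon> > 0\<close>, so the suprema below
  only involve genuine values of \<open>R\<close> and are finite for small \<open>\<epsilon>\<close>.\<close>

definition E_e :: "(real^'n::finite) set \<Rightarrow> 'n gfun set" where
  "E_e \<Omega> = {R \<in> U_set \<Omega> \<rightarrow>\<^sub>E UNIV.
     \<forall>\<phi>\<in>\<A> 0. smooth_on {x. (\<phi>, x) \<in> U_set \<Omega>} (\<lambda>x. R (\<phi>, x))}"

definition E_M :: "(real^'n::finite) set \<Rightarrow> 'n gfun set" where
  "E_M \<Omega> = {R \<in> E_e \<Omega>. \<forall>K \<alpha>. compact K \<and> K \<subseteq> \<Omega> \<longrightarrow>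
     (\<exists>N\<ge>1. \<forall>\<phi>\<in>\<A> N.
        (\<lambda>\<epsilon>. sup_norm_on K (mi_deriv \<alpha> (\<lambda>x. R (scale \<epsilon> \<phi>, x))))
          \<in> O[at_right 0](\<lambda>\<epsilon>. 1 / \<epsilon> ^ N))}"

definition N_e :: "(real^'n::finite) set \<Rightarrow> 'n gfun set" where
  "N_e \<Omega> = {R \<in> E_e \<Omega>. \<forall>K \<alpha>. compact K \<and> K \<subseteq> \<Omega> \<longrightarrow>
     (\<forall>m\<ge>1. \<exists>q\<ge>1. \<forall>\<phi>\<in>\<A> q.
        (\<lambda>\<epsilon>. sup_norm_on K (mi_deriv \<alpha> (\<lambda>x. R (scale \<epsilon> \<phi>, x))))
          \<in> O[at_right 0](\<lambda>\<epsilon>. \<epsilon> ^ m))}"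

definition G_e :: "(real^'n::finite) set \<Rightarrow> 'n gfun set ring" where
  "G_e \<Omega> = pointwise_ring (U_set \<Omega>) (E_M \<Omega>) Quot N_e \<Omega>"

type_synonym 'n gnum = "(real^'n \<Rightarrow> complex) \<Rightarrow> complex"

definition C_M :: "'n::finite gnum set" where
  "C_M = {r \<in> \<A> 0 \<rightarrow>\<^sub>E UNIV. \<exists>N\<ge>1. \<forall>\<phi>\<in>\<A> N.
     (\<lambda>\<epsilon>. cmod (r (scale \<epsilon> \<phi>))) \<in> O[at_right 0](\<lambda>\<epsilon>. 1 / \<epsilon> ^ N)}"

definition C_N :: "'n::finite gnum set" where
  "C_N = {r \<in> \<A> 0 \<rightarrow>\<^sub>E UNIV. \<forall>m\<ge>1. \<exists>q\<ge>1. \<forall>\<phi>\<in>\<A> q.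
     (\<lambda>\<epsilon>. cmod (r (scale \<epsilon> \<phi>))) \<in> O[at_right 0](\<lambda>\<epsilon>. \<epsilon> ^ m)}"

definition C_M_ring :: "'n::finite gnum ring" where
  "C_M_ring = pointwise_ring (\<A> 0) C_M"

definition gen_numbers :: "'n::finite gnum set ring" where
  "gen_numbers = C_M_ring Quot C_N"

type_synonym 'n gpoint = "(real^'n \<Rightarrow> complex) \<Rightarrow> real^'n"

definition Omega_M :: "(real^'n::finite) set \<Rightarrow> 'n gpoint set" where
  "Omega_M \<Omega> = {X \<in> \<A> 0 \<rightarrow>\<^sub>E \<Omega>.
     (\<forall>\<phi>\<in>\<A> 0. \<forall>\<^sub>F \<epsilon> in at_right 0. (scale \<epsilon> \<phi>, X (scale \<epsilon> \<phi>)) \<in> U_set \<Omega>) \<and>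
     (\<exists>N\<ge>1. \<forall>\<phi>\<in>\<A> N.
        (\<lambda>\<epsilon>. norm (X (scale \<epsilon> \<phi>))) \<in> O[at_right 0](\<lambda>\<epsilon>. 1 / \<epsilon> ^ N))}"

definition point_equiv :: "(real^'n::finite) set \<Rightarrow> ('n gpoint \<times> 'n gpoint) set" where
  "point_equiv \<Omega> = {(X, Y). X \<in> Omega_M \<Omega> \<and> Y \<in> Omega_M \<Omega> \<and>
     (\<forall>m\<ge>1. \<exists>q\<ge>1. \<forall>\<phi>\<in>\<A> q.
        (\<lambda>\<epsilon>. norm (X (scale \<epsilon> \<phi>) - Y (scale \<epsilon> \<phi>))) \<in> O[at_right 0](\<lambda>\<epsilon>. \<epsilon> ^ m))}"

definition gen_points :: "(real^'n::finite) set \<Rightarrow> 'n gpoint set set" where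
  "gen_points \<Omega> = Omega_M \<Omega> // point_equiv \<Omega>"

definition compactly_supported :: "(real^'n::finite) set \<Rightarrow> 'n gpoint \<Rightarrow> bool" where
  "compactly_supported \<Omega> X \<longleftrightarrow>
     (\<exists>K. compact K \<and> K \<subseteq> \<Omega> \<and>
       (\<exists>N\<ge>1. \<forall>\<phi>\<in>\<A> N. \<forall>\<^sub>F \<epsilon> in at_right 0. X (scale \<epsilon> \<phi>) \<in> K))"

definition gen_points_c :: "(real^'n::finite) set \<Rightarrow> 'n gpoint set set" where
  "gen_points_c \<Omega> = {\<xi> \<in> gen_points \<Omega>. \<exists>X\<in>\<xi>. compactly_supported \<Omega> X}"

definition eval_at :: "(real^'n::finite) set \<Rightarrow> 'n gfun \<Rightarrow> 'n gpoint \<Rightarrow> 'n gnum" where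
  "eval_at \<Omega> R X = (\<lambda>\<phi>\<in>\<A> 0. if (\<phi>, X \<phi>) \<in> U_set \<Omega> then R (\<phi>, X \<phi>) else 0)"

text \<open>The class on the right does not depend on the representatives \<open>R\<close> and \<open>X\<close> when
  \<open>\<rho> \<in> carrier (G_e \<Omega>)\<close> and \<open>\<xi> \<in> gen_points_c \<Omega>\<close>.\<close>

definition point_value ::
  "(real^'n::finite) set \<Rightarrow> 'n gfun set \<Rightarrow> 'n gpoint set \<Rightarrow> 'n gnum set" where
  "point_value \<Omega> \<rho> \<xi> = (THE c. \<exists>R\<in>\<rho>. \<exists>X\<in>\<xi>. compactly_supported \<Omega> X \<and>
     c = C_N +>\<^bsub>C_M_ring\<^esub> eval_at \<Omega> R X)"

end

theory Submission
  imports Defs "HOL-Library.Sublist"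
begin

text \<open>
  If \<open>R S = 1 + J\<close> with a negligible \<open>J\<close>, then evaluation at a compactly supported point \<open>X\<close> gives
  \<open>R(X) S(X) = 1 + J(X)\<close> with a negligible number \<open>J(X)\<close>, so invertibility passes to point values.
  That the point value does not depend on the representatives is a consequence of the mean value
  theorem (\<open>eval_at_point_diff_negligible\<close>, \<open>point_value_eq\<close>).

  Conversely, let all point values be invertible and let \<open>K\<close> be a compact subset of \<open>\<Omega>\<close>. The map that
  sends a test function \<open>\<psi>\<close> to a minimizer of \<open>|R(\<psi>, x)|\<close> over \<open>x \<in> K\<close> is a compactly supported
  generalized point (\<open>argmin_point\<close>). As the value of \<open>R\<close> there is invertible, the minimum is bounded
  from below by a power of \<open>\<epsilon>\<close>, and with it \<open>R\<close> on all of \<open>K\<close> (\<open>uniform_lower_bound\<close>).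

  It remains to build one global inverse from these asymptotic bounds on single compact sets. Let \<open>e(\<psi>)\<close>
  be the exponential of minus the maximum of \<open>|\<psi>|\<close>; it is positive, and negligible because scaling
  multiplies that maximum by \<open>\<epsilon>\<^sup>-\<^sup>n\<close>. Then \<open>S = cnj R / (|R|\<^sup>2 + e)\<close> is smooth wherever \<open>R\<close> is defined,
  and \<open>R S = 1 - e / (|R|\<^sup>2 + e)\<close> differs from 1 by a negligible function (\<open>E_M_inverse_modulo_N_e\<close>).

  The derivatives of \<open>S\<close> are controlled by the general fact that a nowhere vanishing moderate function
  with a moderately bounded reciprocal has a moderate reciprocal (\<open>all_derivs_inverse\<close>).
\<close>

section \<open>Iterated partial derivatives\<close>

lemma partial_deriv_eq:
  assumes "(f has_derivative f') (at x)"
  shows "partial_deriv i f x = f' (axis i 1)"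
proof -
  have "(f has_derivative f') (at (x + 0 *\<^sub>R axis i 1))" using assms by simp
  then have "((\<lambda>t. f (x + t *\<^sub>R axis i 1)) has_derivative (\<lambda>t. f' (t *\<^sub>R axis i 1))) (at 0)"
    by (rule has_derivative_compose[rotated]) (auto intro!: derivative_eq_intros)
  moreover have "f' (t *\<^sub>R axis i 1) = t *\<^sub>R f' (axis i 1)" for t
    using assms by (simp add: has_derivative_linear linear_cmul)
  ultimately show ?thesis
    unfolding partial_deriv_def by (intro vector_derivative_at) (simp add: has_vector_derivative_def)
qed

lemma partial_deriv_cong:
  assumes "open S" "x \<in> S" and eq: "\<And>y. y \<in> S \<Longrightarrow> f y = g y"
  shows "partial_deriv i f x = partial_deriv i g x"
proof -
  have ev: "\<forall>\<^sub>F t in nhds 0. x + t *\<^sub>R axis i 1 \<in> S"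
  proof -
    have "((\<lambda>t. x + t *\<^sub>R axis i 1) \<longlongrightarrow> x + 0 *\<^sub>R axis i 1) (nhds (0::real))"
      by (intro tendsto_intros filterlim_ident)
    then show ?thesis using assms(1,2) topological_tendstoD by fastforce
  qed
  show ?thesis unfolding partial_deriv_def
    by (rule vector_derivative_cong_eq) (use ev eq in \<open>auto elim: eventually_mono\<close>)
qed

lemma differentiable_on_cong:
  assumes "\<And>x. x \<in> S \<Longrightarrow> f x = g x" "f differentiable_on S"
  shows "g differentiable_on S"
  unfolding differentiable_on_def differentiable_def
proof
  fix x assume x: "x \<in> S"
  then obtain D where "(f has_derivative D) (at x within S)"
    using assms(2) unfolding differentiable_on_def differentiable_def by blast
  then have "(g has_derivative D) (at x within S)"
    by (rule has_derivative_transform[OF x, rotated]) (simp add: assms(1))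
  then show "\<exists>D. (g has_derivative D) (at x within S)" by blast
qed

text \<open>Smoothness is only known on open slices, while \<^const>\<open>partial_deriv\<close> is a total
  operation. Every calculation with derivatives therefore takes place inside an open set and is
  transported along this locality principle.\<close>

lemma iterated_partial_deriv_cong:
  assumes "open S" "x \<in> S" and "\<And>y. y \<in> S \<Longrightarrow> f y = g y"
  shows "fold partial_deriv is f x = fold partial_deriv is g x"
  using assms
proof (induction "is" arbitrary: f g)
  case (Cons i "is")
  have "fold partial_deriv is (partial_deriv i f) x = fold partial_deriv is (partial_deriv i g) x"
    by (rule Cons.IH[OF Cons.prems(1,2) partial_deriv_cong[OF Cons.prems(1) _ Cons.prems(3)]])
  then show ?case by simp
qed simp

lemma smooth_on_cong:
  assumes "open S" and "\<And>y. y \<in> S \<Longrightarrow> f y = g y" and "smooth_on S f"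
  shows "smooth_on S g"
  unfolding smooth_on_def
proof
  fix "is"
  show "fold partial_deriv is g differentiable_on S"
  proof (rule differentiable_on_cong[where f = "fold partial_deriv is f"])
    show "fold partial_deriv is f x = fold partial_deriv is g x" if "x \<in> S" for x
      by (rule iterated_partial_deriv_cong[OF assms(1) that assms(2)])
    show "fold partial_deriv is f differentiable_on S" using assms(3) by (simp add: smooth_on_def)
  qed
qed

lemma smooth_on_partial_deriv:
  assumes "smooth_on S f" shows "smooth_on S (partial_deriv i f)"
  unfolding smooth_on_def
proof
  fix "is"
  have "fold partial_deriv (i # is) f differentiable_on S" using assms unfolding smooth_on_def by blast
  then show "fold partial_deriv is (partial_deriv i f) differentiable_on S" by simp
qed

lemma smooth_on_iterated_partial_deriv: "smooth_on S f \<Longrightarrow> smooth_on S (fold partial_deriv is f)"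
  by (induction "is" arbitrary: f) (auto intro: smooth_on_partial_deriv)

lemma smooth_on_imp_differentiable_on:
  assumes "smooth_on S f" shows "f differentiable_on S"
proof -
  have "fold partial_deriv [] f differentiable_on S" using assms unfolding smooth_on_def by blast
  then show ?thesis by simp
qed

lemma smooth_on_imp_continuous_on: "smooth_on S f \<Longrightarrow> continuous_on S f"
  by (simp add: differentiable_imp_continuous_on smooth_on_imp_differentiable_on)

lemma partial_deriv_add:
  assumes "f differentiable at x" "g differentiable at x"
  shows "partial_deriv i (\<lambda>x. f x + g x) x = partial_deriv i f x + partial_deriv i g x"
proof -
  obtain f' g' where d: "(f has_derivative f') (at x)" "(g has_derivative g') (at x)"
    using assms unfolding differentiable_def by blast
  show ?thesis
    using partial_deriv_eq[OF has_derivative_add[OF d]] d[THEN partial_deriv_eq] by simp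
qed

lemma partial_deriv_mult:
  assumes "f differentiable at x" "g differentiable at x"
  shows "partial_deriv i (\<lambda>x. f x * g x) x = partial_deriv i f x * g x + f x * partial_deriv i g x"
proof -
  obtain f' g' where d: "(f has_derivative f') (at x)" "(g has_derivative g') (at x)"
    using assms unfolding differentiable_def by blast
  show ?thesis
    using partial_deriv_eq[OF has_derivative_mult[OF d]] d[THEN partial_deriv_eq] by simp
qed

lemma partial_deriv_inverse:
  assumes "f differentiable at x" "f x \<noteq> 0"
  shows "partial_deriv i (\<lambda>x. inverse (f x)) x =
    - 1 * (partial_deriv i f x * (inverse (f x) * inverse (f x)))"
proof -
  obtain f' where d: "(f has_derivative f') (at x)"
    using assms unfolding differentiable_def by blast
  show ?thesis
    using partial_deriv_eq[OF Deriv.has_derivative_inverse[OF assms(2) d]] partial_deriv_eq[OF d]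
    by simp
qed

lemma partial_deriv_cnj:
  assumes "f differentiable at x"
  shows "partial_deriv i (\<lambda>x. cnj (f x)) x = cnj (partial_deriv i f x)"
proof -
  obtain f' where d: "(f has_derivative f') (at x)"
    using assms unfolding differentiable_def by blast
  show ?thesis
    using partial_deriv_eq[OF bounded_linear.has_derivative[OF bounded_linear_cnj d]]
      partial_deriv_eq[OF d] by simp
qed

lemma partial_deriv_const: "partial_deriv i (\<lambda>x. c) = (\<lambda>x. 0)"
  by (rule ext, rule partial_deriv_eq[OF has_derivative_const])

text \<open>In an induction on a list of directions, the derivative of a product is a sum of products, and such a
  sum is only known to be differentiable to a lower order at that stage. Counting the order of
  differentiability makes the closure properties provable by induction on that order.\<close>

primrec times_differentiable_on ::
  "nat \<Rightarrow> (real^'n::finite \<Rightarrow> complex) \<Rightarrow> (real^'n) set \<Rightarrow> bool" where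
  "times_differentiable_on 0 f S \<longleftrightarrow> f differentiable_on S"
| "times_differentiable_on (Suc k) f S \<longleftrightarrow>
     f differentiable_on S \<and> (\<forall>i. times_differentiable_on k (partial_deriv i f) S)"

lemma smooth_on_iff_times_differentiable_on:
  "smooth_on S f \<longleftrightarrow> (\<forall>k. times_differentiable_on k f S)"
proof
  assume "smooth_on S f"
  then have "times_differentiable_on k f S" for k
    by (induction k arbitrary: f) (auto intro: smooth_on_imp_differentiable_on smooth_on_partial_deriv)
  then show "\<forall>k. times_differentiable_on k f S" by blast
next
  assume "\<forall>k. times_differentiable_on k f S"
  moreover have "times_differentiable_on (length is) f S \<Longrightarrow> fold partial_deriv is f differentiable_on S" for "is"
    by (induction "is" arbitrary: f) auto
  ultimately show "smooth_on S f" unfolding smooth_on_def by blast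
qed

lemma times_differentiable_on_Suc_imp:
  "times_differentiable_on (Suc k) f S \<Longrightarrow> times_differentiable_on k f S"
  by (induction k arbitrary: f) auto

lemma times_differentiable_on_cong:
  assumes "open S" "\<And>y. y \<in> S \<Longrightarrow> f y = g y" "times_differentiable_on k f S"
  shows "times_differentiable_on k g S"
  using assms(2,3)
proof (induction k arbitrary: f g)
  case 0
  then show ?case using differentiable_on_cong[of S f g] by simp
next
  case (Suc k)
  have "times_differentiable_on k (partial_deriv i g) S" for i
  proof (rule Suc.IH)
    show "partial_deriv i f y = partial_deriv i g y" if "y \<in> S" for y
      by (rule partial_deriv_cong[OF assms(1) that Suc.prems(1)])
  qed (use Suc.prems in simp)
  then show ?case using Suc.prems differentiable_on_cong[of S f g] by simp
qed

lemma times_differentiable_on_const: "times_differentiable_on k (\<lambda>x. c) S"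
  by (induction k arbitrary: c) (auto simp: partial_deriv_const)

lemma times_differentiable_on_add:
  assumes "open S" "times_differentiable_on k f S" "times_differentiable_on k g S"
  shows "times_differentiable_on k (\<lambda>x. f x + g x) S"
  using assms(2,3)
proof (induction k arbitrary: f g)
  case (Suc k)
  have "times_differentiable_on k (partial_deriv i (\<lambda>x. f x + g x)) S" for i
  proof (rule times_differentiable_on_cong[OF assms(1)])
    show "times_differentiable_on k (\<lambda>x. partial_deriv i f x + partial_deriv i g x) S"
      using Suc by simp
  qed (use Suc.prems assms(1) in \<open>simp add: partial_deriv_add differentiable_on_eq_differentiable_at\<close>)
  then show ?case using Suc.prems by (simp add: differentiable_on_def)
qed simp

lemma times_differentiable_on_mult:
  assumes "open S" "times_differentiable_on k f S" "times_differentiable_on k g S"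
  shows "times_differentiable_on k (\<lambda>x. f x * g x) S"
  using assms(2,3)
proof (induction k arbitrary: f g)
  case (Suc k)
  have "times_differentiable_on k (partial_deriv i (\<lambda>x. f x * g x)) S" for i
  proof (rule times_differentiable_on_cong[OF assms(1)])
    show "times_differentiable_on k (\<lambda>x. partial_deriv i f x * g x + f x * partial_deriv i g x) S"
      using Suc times_differentiable_on_Suc_imp[OF Suc.prems(1)] times_differentiable_on_Suc_imp[OF Suc.prems(2)]
      by (intro times_differentiable_on_add[OF assms(1)]) auto
  qed (use Suc.prems assms(1) in \<open>simp add: partial_deriv_mult differentiable_on_eq_differentiable_at\<close>)
  then show ?case using Suc.prems by (simp add: differentiable_on_def)
qed simp

lemma times_differentiable_on_inverse:
  assumes "open S" "times_differentiable_on k f S" and nz: "\<And>x. x \<in> S \<Longrightarrow> f x \<noteq> 0"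
  shows "times_differentiable_on k (\<lambda>x. inverse (f x)) S"
  using assms(2)
proof (induction k)
  case 0
  then show ?case using nz by (simp add: differentiable_on_def differentiable_inverse)
next
  case (Suc k)
  have "times_differentiable_on k (partial_deriv i (\<lambda>x. inverse (f x))) S" for i
  proof (rule times_differentiable_on_cong[OF assms(1)])
    show "times_differentiable_on k
      (\<lambda>x. - 1 * (partial_deriv i f x * (inverse (f x) * inverse (f x)))) S"
      using Suc times_differentiable_on_Suc_imp[OF Suc.prems]
      by (intro times_differentiable_on_mult[OF assms(1)] times_differentiable_on_const) auto
  qed (use Suc.prems assms(1) nz in
      \<open>simp add: partial_deriv_inverse differentiable_on_eq_differentiable_at del: minus_mult_left mult_minus1\<close>)
  then show ?case using Suc.prems nz by (simp add: differentiable_on_def differentiable_inverse)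
qed

lemma times_differentiable_on_cnj:
  assumes "open S" "times_differentiable_on k f S"
  shows "times_differentiable_on k (\<lambda>x. cnj (f x)) S"
  using assms(2)
proof (induction k arbitrary: f)
  case 0
  then show ?case unfolding times_differentiable_on.simps differentiable_on_def differentiable_def
    by (blast intro: bounded_linear.has_derivative[OF bounded_linear_cnj])
next
  case (Suc k)
  have "times_differentiable_on k (partial_deriv i (\<lambda>x. cnj (f x))) S" for i
  proof (rule times_differentiable_on_cong[OF assms(1)])
    show "times_differentiable_on k (\<lambda>x. cnj (partial_deriv i f x)) S"
      using Suc by simp
  qed (use Suc.prems assms(1) in \<open>simp add: partial_deriv_cnj differentiable_on_eq_differentiable_at\<close>)
  moreover have "(\<lambda>x. cnj (f x)) differentiable_on S"
    using Suc.prems unfolding differentiable_on_def differentiable_def times_differentiable_on.simps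
    by (blast intro: bounded_linear.has_derivative[OF bounded_linear_cnj])
  ultimately show ?case by simp
qed

lemma smooth_on_const: "smooth_on S (\<lambda>x. c)"
  by (simp add: smooth_on_iff_times_differentiable_on times_differentiable_on_const)

lemma smooth_on_add: "open S \<Longrightarrow> smooth_on S f \<Longrightarrow> smooth_on S g \<Longrightarrow> smooth_on S (\<lambda>x. f x + g x)"
  by (simp add: smooth_on_iff_times_differentiable_on times_differentiable_on_add)

lemma smooth_on_mult: "open S \<Longrightarrow> smooth_on S f \<Longrightarrow> smooth_on S g \<Longrightarrow> smooth_on S (\<lambda>x. f x * g x)"
  by (simp add: smooth_on_iff_times_differentiable_on times_differentiable_on_mult)

lemma smooth_on_inverse:
  "open S \<Longrightarrow> smooth_on S f \<Longrightarrow> (\<And>x. x \<in> S \<Longrightarrow> f x \<noteq> 0) \<Longrightarrow> smooth_on S (\<lambda>x. inverse (f x))"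
  by (simp add: smooth_on_iff_times_differentiable_on times_differentiable_on_inverse)

lemma smooth_on_cnj: "open S \<Longrightarrow> smooth_on S f \<Longrightarrow> smooth_on S (\<lambda>x. cnj (f x))"
  by (simp add: smooth_on_iff_times_differentiable_on times_differentiable_on_cnj)

text \<open>The chain rule for \<open>y \<mapsto> c f(a y)\<close>, of which the scaling operator is an instance; the extra factor
  \<open>a\<close> stays inside the constant, so that the rule can be iterated.\<close>

lemma partial_deriv_affine:
  assumes "f differentiable at (a *\<^sub>R x)"
  shows "partial_deriv i (\<lambda>y. c * f (a *\<^sub>R y)) x = (c * of_real a) * partial_deriv i f (a *\<^sub>R x)"
proof -
  obtain f' where d: "(f has_derivative f') (at (a *\<^sub>R x))"
    using assms unfolding differentiable_def by blast
  have "((\<lambda>y. f (a *\<^sub>R y)) has_derivative (\<lambda>h. f' (a *\<^sub>R h))) (at x)"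
    using has_derivative_compose[OF has_derivative_scaleR_right[OF has_derivative_ident] d] .
  then have "((\<lambda>y. c * f (a *\<^sub>R y)) has_derivative (\<lambda>h. c * f' (a *\<^sub>R h))) (at x)"
    by (rule has_derivative_mult_right)
  then have "partial_deriv i (\<lambda>y. c * f (a *\<^sub>R y)) x = c * f' (a *\<^sub>R axis i 1)"
    by (rule partial_deriv_eq)
  also have "f' (a *\<^sub>R axis i 1) = a *\<^sub>R f' (axis i 1)"
    using d by (simp add: has_derivative_linear linear_cmul)
  finally show ?thesis using partial_deriv_eq[OF d] by (simp add: scaleR_conv_of_real)
qed

lemma smooth_on_affine:
  assumes "smooth_on UNIV f"
  shows "smooth_on UNIV (\<lambda>y. c * f (a *\<^sub>R y))"
proof -
  have "fold partial_deriv is (\<lambda>y. c * f (a *\<^sub>R y)) differentiable_on UNIV" for "is"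
    using assms
  proof (induction "is" arbitrary: f c)
    case Nil
    then have "f differentiable at x" for x
      by (auto dest!: smooth_on_imp_differentiable_on simp: differentiable_on_def)
    then have "(\<lambda>y. f (a *\<^sub>R y)) differentiable at x" for x
      by (intro differentiable_compose[of f "\<lambda>y. a *\<^sub>R y"]) auto
    then have "(\<lambda>y. c * f (a *\<^sub>R y)) differentiable at x" for x
      by (rule differentiable_mult[OF differentiable_const])
    then show ?case by (simp add: differentiable_on_def)
  next
    case (Cons i "is")
    have "f differentiable at x" for x
      using Cons.prems by (auto dest!: smooth_on_imp_differentiable_on simp: differentiable_on_def)
    then have "partial_deriv i (\<lambda>y. c * f (a *\<^sub>R y)) = (\<lambda>x. (c * of_real a) * partial_deriv i f (a *\<^sub>R x))"
      by (intro ext partial_deriv_affine)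
    then show ?case
      using Cons.IH[OF smooth_on_partial_deriv[OF Cons.prems], of "c * of_real a" i] by simp
  qed
  then show ?thesis by (simp add: smooth_on_def)
qed

section \<open>Scaling of test functions\<close>

lemma moment_functions_antimono: "p \<le> q \<Longrightarrow> \<A> q \<subseteq> \<A> p"
  unfolding moment_functions_def by auto

lemma moment_functions_max: "\<A> (max p q) = \<A> p \<inter> \<A> q"
  unfolding moment_functions_def by (auto simp: le_max_iff_disj)

lemma moment_functions_le_0: "\<phi> \<in> \<A> q \<Longrightarrow> \<phi> \<in> \<A> 0"
  using moment_functions_antimono[of 0 q] by auto

lemma supp_scale:
  assumes "\<epsilon> > 0"
  shows "supp (scale \<epsilon> \<phi>) = (*\<^sub>R) \<epsilon> ` supp \<phi>"
proof -
  have "{x. scale \<epsilon> \<phi> x \<noteq> 0} = (*\<^sub>R) \<epsilon> ` {x. \<phi> x \<noteq> 0}"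
    using assms by (auto simp: scale_def image_iff intro!: exI[of _ "(1 / \<epsilon>) *\<^sub>R _"])
  then show ?thesis by (simp add: supp_def closure_scaleR)
qed

text \<open>The factor \<open>\<epsilon>\<^sup>-\<^sup>n\<close> in the scaling operator cancels the Jacobian of the substitution
  \<open>x \<mapsto> \<epsilon> x\<close>.\<close>

lemma lborel_integral_scale:
  fixes g :: "real^'n::finite \<Rightarrow> complex"
  assumes "\<epsilon> > 0" and [measurable]: "g \<in> borel_measurable borel"
  shows "(LINT x|lborel. scale \<epsilon> g x) = (LINT x|lborel. g x)"
proof -
  have "(LINT x|lborel. scale \<epsilon> g x)
      = (LINT x|density (distr lborel borel (\<lambda>x. 0 + \<epsilon> *\<^sub>R x)) (\<lambda>_. \<bar>\<epsilon>\<bar> ^ DIM(real^'n)). scale \<epsilon> g x)"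
    using lborel_affine[of \<epsilon> "0 :: real^'n"] assms(1) by simp
  also have "\<dots> = (LINT x|lborel. \<bar>\<epsilon>\<bar> ^ DIM(real^'n) *\<^sub>R scale \<epsilon> g (0 + \<epsilon> *\<^sub>R x))"
    unfolding scale_def by (subst integral_density) (auto simp: integral_distr)
  also have "\<dots> = (LINT x|lborel. g x)"
    using assms(1) by (intro Bochner_Integration.integral_cong) (simp_all add: scale_def scaleR_conv_of_real[where 'a = complex])
  finally show ?thesis .
qed

lemma mi_power_scaleR: "mi_power (c *\<^sub>R x) \<alpha> = c ^ mi_order \<alpha> * mi_power x \<alpha>"
  by (simp add: mi_power_def mi_order_def power_mult_distrib prod.distrib power_sum)

lemma moment_functions_borel_measurable [measurable]: "\<phi> \<in> \<A> q \<Longrightarrow> \<phi> \<in> borel_measurable borel"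
  unfolding moment_functions_def test_functions_def
  by (auto intro: borel_measurable_continuous_onI smooth_on_imp_continuous_on)

text \<open>Scaling preserves the total mass and multiplies the moment of order \<open>\<alpha>\<close> by
  \<open>\<epsilon>\<^bsup>|\<alpha>|\<^esup>\<close>, so vanishing moments stay zero.\<close>

lemma scale_moment_functions:
  assumes "\<epsilon> > 0" and \<phi>: "\<phi> \<in> \<A> q"
  shows "scale \<epsilon> \<phi> \<in> \<A> q"
proof -
  note [measurable] = moment_functions_borel_measurable[OF \<phi>]
  have "smooth_on UNIV (scale \<epsilon> \<phi>)"
    unfolding scale_def by (rule smooth_on_affine) (use \<phi> in \<open>simp add: moment_functions_def test_functions_def\<close>)
  moreover have "compact (supp (scale \<epsilon> \<phi>))"
    using \<phi> assms(1) by (auto simp: moment_functions_def test_functions_def supp_scale compact_scaling)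
  moreover have "(LINT x|lborel. scale \<epsilon> \<phi> x) = 1"
    using lborel_integral_scale[of \<epsilon> \<phi>] assms by (simp add: moment_functions_def)
  moreover have "(LINT x|lborel. of_real (mi_power x \<alpha>) * scale \<epsilon> \<phi> x) = 0"
    if "1 \<le> mi_order \<alpha>" "mi_order \<alpha> \<le> q" for \<alpha>
  proof -
    let ?g = "\<lambda>x. of_real (mi_power x \<alpha>) * \<phi> x"
    have m: "?g \<in> borel_measurable borel" unfolding mi_power_def by measurable
    have "of_real (mi_power x \<alpha>) * scale \<epsilon> \<phi> x = of_real (\<epsilon> ^ mi_order \<alpha>) * scale \<epsilon> ?g x" for x
      using assms(1) by (simp add: scale_def mi_power_scaleR power_one_over)
    then have "(LINT x|lborel. of_real (mi_power x \<alpha>) * scale \<epsilon> \<phi> x)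
        = of_real (\<epsilon> ^ mi_order \<alpha>) * (LINT x|lborel. scale \<epsilon> ?g x)" by simp
    also have "\<dots> = 0"
      using lborel_integral_scale[OF assms(1) m] \<phi> that by (simp add: moment_functions_def)
    finally show ?thesis .
  qed
  ultimately show ?thesis by (simp add: moment_functions_def test_functions_def)
qed

lemma eventually_scale_moment_functions: "\<phi> \<in> \<A> q \<Longrightarrow> \<forall>\<^sub>F \<epsilon> in at_right 0. scale \<epsilon> \<phi> \<in> \<A> q"
  using eventually_at_right_less[of 0] by (rule eventually_mono) (rule scale_moment_functions)

text \<open>The natural domain of \<open>x \<mapsto> R(\<psi>, x)\<close>. It is empty unless \<open>\<psi>\<close> is a test
  function of integral one.\<close>

definition slice :: "(real^'n::finite) set \<Rightarrow> (real^'n \<Rightarrow> complex) \<Rightarrow> (real^'n) set" where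
  "slice \<Omega> \<psi> = {x. (\<psi>, x) \<in> U_set \<Omega>}"

text \<open>For \<open>\<psi> \<in> \<A> 0\<close>, the points of \<open>\<Omega>\<close> outside the slice are those of the form \<open>z - y\<close> with
  \<open>z \<notin> \<Omega>\<close> and \<open>y\<close> in the compact support of \<open>\<psi>\<close>; the difference of a closed and a
  compact set is closed.\<close>

lemma open_slice:
  assumes "open \<Omega>"
  shows "open (slice \<Omega> \<psi>)"
proof (cases "\<psi> \<in> \<A> 0")
  case True
  have "slice \<Omega> \<psi> = \<Omega> - (\<Union>z\<in>-\<Omega>. \<Union>y\<in>supp \<psi>. {z - y})"
    using True by (force simp: slice_def U_set_def image_subset_iff algebra_simps)
  moreover have "closed (\<Union>z\<in>-\<Omega>. \<Union>y\<in>supp \<psi>. {z - y})"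
    using assms True by (intro closed_compact_differences) (auto simp: moment_functions_def test_functions_def)
  ultimately show ?thesis using assms by (simp add: open_Diff)
qed (simp add: slice_def U_set_def)

text \<open>The support of the scaled function shrinks to the origin, while a compact set keeps a positive
  distance from the complement of \<open>\<Omega>\<close>.\<close>

lemma eventually_subset_slice:
  assumes "open \<Omega>" "compact K" "K \<subseteq> \<Omega>" "\<phi> \<in> \<A> 0"
  shows "\<forall>\<^sub>F \<epsilon> in at_right 0. K \<subseteq> slice \<Omega> (scale \<epsilon> \<phi>)"
proof -
  obtain \<delta> where \<delta>: "\<delta> > 0" "(\<Union>x\<in>K. ball x \<delta>) \<subseteq> \<Omega>"
    using compact_subset_open_imp_ball_epsilon_subset assms(1-3) by metis
  have "bounded (supp \<phi>)"
    using assms(4) by (auto simp: moment_functions_def test_functions_def compact_imp_bounded)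
  then obtain M where M: "M > 0" "\<And>y. y \<in> supp \<phi> \<Longrightarrow> norm y \<le> M" using bounded_pos by metis
  have "\<forall>\<^sub>F \<epsilon> in at_right 0. \<epsilon> \<in> {0<..<\<delta> / M}"
    using \<delta> M by (intro eventually_at_right_real) simp
  then show ?thesis
  proof (rule eventually_mono)
    fix \<epsilon> assume \<epsilon>: "\<epsilon> \<in> {0<..<\<delta> / M}"
    have "\<epsilon> *\<^sub>R y + x \<in> \<Omega>" if "x \<in> K" "y \<in> supp \<phi>" for x y
    proof -
      have "norm (\<epsilon> *\<^sub>R y) \<le> \<epsilon> * M" using \<epsilon> M(2)[OF that(2)] by simp
      also have "\<dots> < \<delta>" using \<epsilon> M(1) by (simp add: field_simps)
      finally have "\<epsilon> *\<^sub>R y + x \<in> ball x \<delta>" by (simp add: dist_norm)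
      then show ?thesis using \<delta>(2) that(1) by blast
    qed
    moreover have "scale \<epsilon> \<phi> \<in> \<A> 0" using \<epsilon> assms(4) by (intro scale_moment_functions) auto
    ultimately show "K \<subseteq> slice \<Omega> (scale \<epsilon> \<phi>)"
      using \<epsilon> assms(3) by (auto simp: slice_def U_set_def supp_scale)
  qed
qed

section \<open>Orders of growth\<close>

text \<open>Generalized functions on a compact set, generalized numbers and generalized points are measured
  by the same asymptotic scale. The index set \<open>B\<close> is the compact set in the first case and
  \<open>{()}\<close> in the other two. With integer exponents \<open>k\<close>, moderateness means that some \<open>k\<close> works,
  and negligibility that all \<open>k\<close> work.\<close>

definition order_bound ::
  "'b set \<Rightarrow> int \<Rightarrow> ((real^'n::finite \<Rightarrow> complex) \<Rightarrow> 'b \<Rightarrow> 'c::real_normed_vector) \<Rightarrow>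
    (real^'n \<Rightarrow> complex) \<Rightarrow> bool" where
  "order_bound B k F \<phi> \<longleftrightarrow>
    (\<exists>C. \<forall>\<^sub>F \<epsilon> in at_right 0. \<forall>b\<in>B. norm (F (scale \<epsilon> \<phi>) b) \<le> C * \<epsilon> powi k)"

text \<open>The number \<open>q\<close> of vanishing moments is not tied to the exponent \<open>k\<close> here, whereas the definition of
  moderateness uses one number \<open>N\<close> for both. As \<open>\<A> q\<close> decreases with \<open>q\<close> and the bounds
  weaken as \<open>k\<close> decreases, both formulations agree (\<open>moderate_iff_bigo\<close>).\<close>

definition growth ::
  "'b set \<Rightarrow> int \<Rightarrow> ((real^'n::finite \<Rightarrow> complex) \<Rightarrow> 'b \<Rightarrow> 'c::real_normed_vector) \<Rightarrow> bool" where
  "growth B k F \<longleftrightarrow> (\<exists>q. \<forall>\<phi>\<in>\<A> q. order_bound B k F \<phi>)"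

definition moderate_on ::
  "'b set \<Rightarrow> ((real^'n::finite \<Rightarrow> complex) \<Rightarrow> 'b \<Rightarrow> 'c::real_normed_vector) \<Rightarrow> bool" where
  "moderate_on B F \<longleftrightarrow> (\<exists>k. growth B k F)"

definition negligible_on ::
  "'b set \<Rightarrow> ((real^'n::finite \<Rightarrow> complex) \<Rightarrow> 'b \<Rightarrow> 'c::real_normed_vector) \<Rightarrow> bool" where
  "negligible_on B F \<longleftrightarrow> (\<forall>k. growth B k F)"

lemma order_boundE:
  assumes "order_bound B k F \<phi>"
  obtains C where "C > 0" "\<forall>\<^sub>F \<epsilon> in at_right 0. 0 < \<epsilon> \<and> (\<forall>b\<in>B. norm (F (scale \<epsilon> \<phi>) b) \<le> C * \<epsilon> powi k)"
proof -
  obtain C where C: "\<forall>\<^sub>F \<epsilon> in at_right 0. \<forall>b\<in>B. norm (F (scale \<epsilon> \<phi>) b) \<le> C * \<epsilon> powi k"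
    using assms unfolding order_bound_def by blast
  have "\<forall>\<^sub>F \<epsilon> in at_right 0. 0 < \<epsilon> \<and> (\<forall>b\<in>B. norm (F (scale \<epsilon> \<phi>) b) \<le> (\<bar>C\<bar> + 1) * \<epsilon> powi k)"
    using C eventually_at_right_less[of 0]
  proof eventually_elim
    case (elim \<epsilon>)
    have "C * \<epsilon> powi k \<le> (\<bar>C\<bar> + 1) * \<epsilon> powi k" using elim by (intro mult_right_mono) auto
    then show ?case using elim by (meson order_trans)
  qed
  then show ?thesis by (intro that[of "\<bar>C\<bar> + 1"]) auto
qed

lemma order_bound_mono:
  assumes "order_bound B k F \<phi>" "l \<le> k"
  shows "order_bound B l F \<phi>"
proof -
  obtain C where C: "C > 0"
    and ev: "\<forall>\<^sub>F \<epsilon> in at_right 0. 0 < \<epsilon> \<and> (\<forall>b\<in>B. norm (F (scale \<epsilon> \<phi>) b) \<le> C * \<epsilon> powi k)"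
    using order_boundE[OF assms(1)] .
  have "\<forall>\<^sub>F \<epsilon> in at_right (0::real). \<epsilon> \<in> {0<..<1}" by (rule eventually_at_right_real) simp
  with ev have "\<forall>\<^sub>F \<epsilon> in at_right 0. \<forall>b\<in>B. norm (F (scale \<epsilon> \<phi>) b) \<le> C * \<epsilon> powi l"
  proof eventually_elim
    case (elim \<epsilon>)
    have "C * \<epsilon> powi k \<le> C * \<epsilon> powi l"
      using elim assms(2) C by (intro mult_left_mono power_int_decreasing) auto
    then show ?case using elim by force
  qed
  then show ?thesis unfolding order_bound_def by blast
qed

text \<open>The common form of all comparison arguments below: domination by a net with known order, where the
  dominating value may be taken at another index and from another index set. In this way bounds pass
  between functions on a compact set and numbers.\<close>

lemma order_bound_transfer:
  assumes "order_bound B' k G \<phi>"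
    and "\<forall>\<^sub>F \<epsilon> in at_right 0. \<forall>b\<in>B. \<exists>b'\<in>B'. norm (F (scale \<epsilon> \<phi>) b) \<le> norm (G (scale \<epsilon> \<phi>) b')"
  shows "order_bound B k F \<phi>"
proof -
  obtain C where "\<forall>\<^sub>F \<epsilon> in at_right 0. \<forall>b\<in>B'. norm (G (scale \<epsilon> \<phi>) b) \<le> C * \<epsilon> powi k"
    using assms(1) unfolding order_bound_def by blast
  with assms(2) have "\<forall>\<^sub>F \<epsilon> in at_right 0. \<forall>b\<in>B. norm (F (scale \<epsilon> \<phi>) b) \<le> C * \<epsilon> powi k"
    by eventually_elim (metis order_trans)
  then show ?thesis unfolding order_bound_def by blast
qed

lemma order_bound_add:
  assumes "order_bound B k F \<phi>" "order_bound B k G \<phi>"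
  shows "order_bound B k (\<lambda>\<psi> b. F \<psi> b + G \<psi> b) \<phi>"
proof -
  obtain C D where "\<forall>\<^sub>F \<epsilon> in at_right 0. \<forall>b\<in>B. norm (F (scale \<epsilon> \<phi>) b) \<le> C * \<epsilon> powi k"
    "\<forall>\<^sub>F \<epsilon> in at_right 0. \<forall>b\<in>B. norm (G (scale \<epsilon> \<phi>) b) \<le> D * \<epsilon> powi k"
    using assms unfolding order_bound_def by blast
  then have "\<forall>\<^sub>F \<epsilon> in at_right 0. \<forall>b\<in>B. norm (F (scale \<epsilon> \<phi>) b + G (scale \<epsilon> \<phi>) b) \<le> (C + D) * \<epsilon> powi k"
    by eventually_elim (auto simp: distrib_right intro: norm_triangle_le add_mono)
  then show ?thesis unfolding order_bound_def by blast
qed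

lemma order_bound_mult:
  fixes F G :: "(real^'n::finite \<Rightarrow> complex) \<Rightarrow> 'b \<Rightarrow> 'c::real_normed_algebra"
  assumes "order_bound B k F \<phi>" "order_bound B l G \<phi>"
  shows "order_bound B (k + l) (\<lambda>\<psi> b. F \<psi> b * G \<psi> b) \<phi>"
proof -
  obtain C where C: "C > 0"
    and F: "\<forall>\<^sub>F \<epsilon> in at_right 0. 0 < \<epsilon> \<and> (\<forall>b\<in>B. norm (F (scale \<epsilon> \<phi>) b) \<le> C * \<epsilon> powi k)"
    using order_boundE[OF assms(1)] .
  obtain D where D: "D > 0"
    and G: "\<forall>\<^sub>F \<epsilon> in at_right 0. 0 < \<epsilon> \<and> (\<forall>b\<in>B. norm (G (scale \<epsilon> \<phi>) b) \<le> D * \<epsilon> powi l)"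
    using order_boundE[OF assms(2)] .
  from F G have "\<forall>\<^sub>F \<epsilon> in at_right 0. \<forall>b\<in>B.
    norm (F (scale \<epsilon> \<phi>) b * G (scale \<epsilon> \<phi>) b) \<le> (C * D) * \<epsilon> powi (k + l)"
  proof eventually_elim
    case (elim \<epsilon>)
    show ?case
    proof
      fix b assume "b \<in> B"
      have "norm (F (scale \<epsilon> \<phi>) b * G (scale \<epsilon> \<phi>) b)
          \<le> norm (F (scale \<epsilon> \<phi>) b) * norm (G (scale \<epsilon> \<phi>) b)" by (rule norm_mult_ineq)
      also have "\<dots> \<le> (C * \<epsilon> powi k) * (D * \<epsilon> powi l)"
        using elim C \<open>b \<in> B\<close> by (intro mult_mono) auto
      also have "\<dots> = (C * D) * \<epsilon> powi (k + l)" using elim by (simp add: power_int_add)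
      finally show "norm (F (scale \<epsilon> \<phi>) b * G (scale \<epsilon> \<phi>) b) \<le> (C * D) * \<epsilon> powi (k + l)" .
    qed
  qed
  then show ?thesis unfolding order_bound_def by blast
qed

lemma growth_mono: "growth B k F \<Longrightarrow> l \<le> k \<Longrightarrow> growth B l F"
  unfolding growth_def using order_bound_mono by blast

lemma growth_transfer:
  assumes "growth B' k G"
    and "\<forall>\<phi>\<in>\<A> p. \<forall>\<^sub>F \<epsilon> in at_right 0. \<forall>b\<in>B. \<exists>b'\<in>B'.
      norm (F (scale \<epsilon> \<phi>) b) \<le> norm (G (scale \<epsilon> \<phi>) b')"
  shows "growth B k F"
proof -
  obtain q where "\<forall>\<phi>\<in>\<A> q. order_bound B' k G \<phi>" using assms(1) unfolding growth_def by blast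
  then have "\<forall>\<phi>\<in>\<A> (max p q). order_bound B k F \<phi>"
    using assms(2) order_bound_transfer[of B' k G _ B F] by (simp add: moment_functions_max)
  then show ?thesis unfolding growth_def by blast
qed

lemma growth_add:
  assumes "growth B k F" "growth B k G"
  shows "growth B k (\<lambda>\<psi> b. F \<psi> b + G \<psi> b)"
proof -
  obtain p q where "\<forall>\<phi>\<in>\<A> p. order_bound B k F \<phi>" "\<forall>\<phi>\<in>\<A> q. order_bound B k G \<phi>"
    using assms unfolding growth_def by blast
  then have "\<forall>\<phi>\<in>\<A> (max p q). order_bound B k (\<lambda>\<psi> b. F \<psi> b + G \<psi> b) \<phi>"
    by (auto simp: moment_functions_max intro!: order_bound_add)
  then show ?thesis unfolding growth_def by blast
qed

lemma growth_mult:
  fixes F G :: "(real^'n::finite \<Rightarrow> complex) \<Rightarrow> 'b \<Rightarrow> 'c::real_normed_algebra"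
  assumes "growth B k F" "growth B l G"
  shows "growth B (k + l) (\<lambda>\<psi> b. F \<psi> b * G \<psi> b)"
proof -
  obtain p q where "\<forall>\<phi>\<in>\<A> p. order_bound B k F \<phi>" "\<forall>\<phi>\<in>\<A> q. order_bound B l G \<phi>"
    using assms unfolding growth_def by blast
  then have "\<forall>\<phi>\<in>\<A> (max p q). order_bound B (k + l) (\<lambda>\<psi> b. F \<psi> b * G \<psi> b) \<phi>"
    by (auto simp: moment_functions_max intro!: order_bound_mult)
  then show ?thesis unfolding growth_def by blast
qed

lemma moderate_transfer:
  assumes "moderate_on B' G"
    and "\<forall>\<phi>\<in>\<A> p. \<forall>\<^sub>F \<epsilon> in at_right 0. \<forall>b\<in>B. \<exists>b'\<in>B'.
      norm (F (scale \<epsilon> \<phi>) b) \<le> norm (G (scale \<epsilon> \<phi>) b')"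
  shows "moderate_on B F"
proof -
  obtain k where "growth B' k G" using assms(1) unfolding moderate_on_def by blast
  then have "growth B k F" using assms(2) by (rule growth_transfer)
  then show ?thesis unfolding moderate_on_def by blast
qed

lemma negligible_transfer:
  assumes "negligible_on B' G"
    and "\<forall>\<phi>\<in>\<A> p. \<forall>\<^sub>F \<epsilon> in at_right 0. \<forall>b\<in>B. \<exists>b'\<in>B'.
      norm (F (scale \<epsilon> \<phi>) b) \<le> norm (G (scale \<epsilon> \<phi>) b')"
  shows "negligible_on B F"
  unfolding negligible_on_def
proof
  fix k
  have "growth B' k G" using assms(1) unfolding negligible_on_def by blast
  then show "growth B k F" using assms(2) by (rule growth_transfer)
qed

lemma negligible_imp_moderate: "negligible_on B F \<Longrightarrow> moderate_on B F"
  unfolding negligible_on_def moderate_on_def by blast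

lemma moderate_add:
  assumes "moderate_on B F" "moderate_on B G"
  shows "moderate_on B (\<lambda>\<psi> b. F \<psi> b + G \<psi> b)"
proof -
  obtain k l where "growth B k F" "growth B l G" using assms unfolding moderate_on_def by blast
  then have "growth B (min k l) F" "growth B (min k l) G" by (simp_all add: growth_mono)
  then have "growth B (min k l) (\<lambda>\<psi> b. F \<psi> b + G \<psi> b)" by (rule growth_add)
  then show ?thesis unfolding moderate_on_def by blast
qed

lemma negligible_add:
  "negligible_on B F \<Longrightarrow> negligible_on B G \<Longrightarrow> negligible_on B (\<lambda>\<psi> b. F \<psi> b + G \<psi> b)"
  unfolding negligible_on_def by (simp add: growth_add)

lemma moderate_mult:
  fixes F G :: "(real^'n::finite \<Rightarrow> complex) \<Rightarrow> 'b \<Rightarrow> 'c::real_normed_algebra"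
  assumes "moderate_on B F" "moderate_on B G"
  shows "moderate_on B (\<lambda>\<psi> b. F \<psi> b * G \<psi> b)"
proof -
  obtain k l where "growth B k F" "growth B l G" using assms unfolding moderate_on_def by blast
  then have "growth B (k + l) (\<lambda>\<psi> b. F \<psi> b * G \<psi> b)" by (rule growth_mult)
  then show ?thesis unfolding moderate_on_def by blast
qed

lemma negligible_mult:
  fixes F G :: "(real^'n::finite \<Rightarrow> complex) \<Rightarrow> 'b \<Rightarrow> 'c::real_normed_algebra"
  assumes "negligible_on B F" "moderate_on B G"
  shows "negligible_on B (\<lambda>\<psi> b. F \<psi> b * G \<psi> b)"
proof -
  obtain l where l: "growth B l G" using assms(2) unfolding moderate_on_def by blast
  have "growth B ((k - l) + l) (\<lambda>\<psi> b. F \<psi> b * G \<psi> b)" for k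
    using assms(1) l by (intro growth_mult) (simp_all add: negligible_on_def)
  then show ?thesis by (simp add: negligible_on_def)
qed

lemma growth_const: "growth B 0 (\<lambda>\<psi> b. c)"
  unfolding growth_def order_bound_def by (auto intro!: exI[of _ "norm c"])

lemma moderate_const: "moderate_on B (\<lambda>\<psi> b. c)"
  using growth_const unfolding moderate_on_def by blast

lemma negligible_zero: "negligible_on B (\<lambda>\<psi> b. 0)"
  unfolding negligible_on_def growth_def order_bound_def by (auto intro!: exI[of _ 0])

lemma moderate_iff_bigo:
  fixes h :: "(real^'n::finite \<Rightarrow> complex) \<Rightarrow> real \<Rightarrow> real"
  assumes "\<And>\<phi> k. \<phi> \<in> \<A> 0 \<Longrightarrow> h \<phi> \<in> O[at_right 0](\<lambda>\<epsilon>. \<epsilon> powi k) \<longleftrightarrow> order_bound B k F \<phi>"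
  shows "(\<exists>N\<ge>1. \<forall>\<phi>\<in>\<A> N. h \<phi> \<in> O[at_right 0](\<lambda>\<epsilon>. 1 / \<epsilon> ^ N)) \<longleftrightarrow> moderate_on B F"
proof -
  have *: "(\<lambda>\<epsilon>::real. 1 / \<epsilon> ^ N) = (\<lambda>\<epsilon>. \<epsilon> powi (- int N))" for N
    by (simp add: power_int_minus field_simps)
  show ?thesis unfolding *
  proof
    assume "\<exists>N\<ge>1. \<forall>\<phi>\<in>\<A> N. h \<phi> \<in> O[at_right 0](\<lambda>\<epsilon>. \<epsilon> powi (- int N))"
    then show "moderate_on B F"
      unfolding moderate_on_def growth_def using assms moment_functions_le_0 by blast
  next
    assume "moderate_on B F"
    then obtain k q where q: "\<forall>\<phi>\<in>\<A> q. order_bound B k F \<phi>" unfolding moderate_on_def growth_def by blast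
    define N where "N = max 1 (max q (nat (- k)))"
    have "order_bound B (- int N) F \<phi>" if "\<phi> \<in> \<A> N" for \<phi>
    proof (rule order_bound_mono)
      have "\<phi> \<in> \<A> q" using that by (simp add: N_def moment_functions_max)
      then show "order_bound B k F \<phi>" using q by blast
    qed (simp add: N_def)
    then show "\<exists>N\<ge>1. \<forall>\<phi>\<in>\<A> N. h \<phi> \<in> O[at_right 0](\<lambda>\<epsilon>. \<epsilon> powi (- int N))"
      using assms moment_functions_le_0
      by (intro exI[of _ N] conjI ballI) (simp add: N_def, simp only: assms moment_functions_le_0)
  qed
qed

lemma negligible_iff_bigo:
  fixes h :: "(real^'n::finite \<Rightarrow> complex) \<Rightarrow> real \<Rightarrow> real"
  assumes "\<And>\<phi> k. \<phi> \<in> \<A> 0 \<Longrightarrow> h \<phi> \<in> O[at_right 0](\<lambda>\<epsilon>. \<epsilon> powi k) \<longleftrightarrow> order_bound B k F \<phi>"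
  shows "(\<forall>m\<ge>1. \<exists>q\<ge>1. \<forall>\<phi>\<in>\<A> q. h \<phi> \<in> O[at_right 0](\<lambda>\<epsilon>. \<epsilon> ^ m)) \<longleftrightarrow> negligible_on B F"
proof -
  have *: "(\<lambda>\<epsilon>::real. \<epsilon> ^ m) = (\<lambda>\<epsilon>. \<epsilon> powi (int m))" for m by simp
  show ?thesis unfolding *
  proof
    assume L: "\<forall>m\<ge>1. \<exists>q\<ge>1. \<forall>\<phi>\<in>\<A> q. h \<phi> \<in> O[at_right 0](\<lambda>\<epsilon>. \<epsilon> powi (int m))"
    have "growth B k F" for k
    proof (rule growth_mono)
      obtain q where "\<forall>\<phi>\<in>\<A> q. h \<phi> \<in> O[at_right 0](\<lambda>\<epsilon>. \<epsilon> powi (int (max 1 (nat k))))"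
        using L[rule_format, of "max 1 (nat k)"] by auto
      then show "growth B (int (max 1 (nat k))) F"
        unfolding growth_def using assms moment_functions_le_0 by blast
    qed simp
    then show "negligible_on B F" by (simp add: negligible_on_def)
  next
    assume R: "negligible_on B F"
    show "\<forall>m\<ge>1. \<exists>q\<ge>1. \<forall>\<phi>\<in>\<A> q. h \<phi> \<in> O[at_right 0](\<lambda>\<epsilon>. \<epsilon> powi (int m))"
    proof (intro allI impI)
      fix m :: nat
      obtain q where "\<forall>\<phi>\<in>\<A> q. order_bound B (int m) F \<phi>"
        using R unfolding negligible_on_def growth_def by blast
      then have "h \<phi> \<in> O[at_right 0](\<lambda>\<epsilon>. \<epsilon> powi (int m))" if "\<phi> \<in> \<A> (max 1 q)" for \<phi>
        using that assms moment_functions_le_0[OF that] by (simp add: moment_functions_max del: power_int_of_nat)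
      then show "\<exists>q\<ge>1. \<forall>\<phi>\<in>\<A> q. h \<phi> \<in> O[at_right 0](\<lambda>\<epsilon>. \<epsilon> powi (int m))"
        by (intro exI[of _ "max 1 q"]) simp
    qed
  qed
qed

lemma norm_bigo_iff_order_bound:
  "(\<lambda>\<epsilon>. norm (f (scale \<epsilon> \<phi>))) \<in> O[at_right 0](\<lambda>\<epsilon>. \<epsilon> powi k) \<longleftrightarrow> order_bound {()} k (\<lambda>\<psi> _. f \<psi>) \<phi>"
proof
  assume "(\<lambda>\<epsilon>. norm (f (scale \<epsilon> \<phi>))) \<in> O[at_right 0](\<lambda>\<epsilon>. \<epsilon> powi k)"
  then obtain C where "\<forall>\<^sub>F \<epsilon> in at_right 0. norm (norm (f (scale \<epsilon> \<phi>))) \<le> C * norm (\<epsilon> powi k)"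
    by (rule landau_o.bigE)
  then have "\<forall>\<^sub>F \<epsilon> in at_right 0. norm (f (scale \<epsilon> \<phi>)) \<le> C * \<epsilon> powi k"
    using eventually_at_right_less[of 0] by eventually_elim (simp add: power_int_abs)
  then show "order_bound {()} k (\<lambda>\<psi> _. f \<psi>) \<phi>" by (auto simp: order_bound_def)
next
  assume "order_bound {()} k (\<lambda>\<psi> _. f \<psi>) \<phi>"
  then obtain C where C: "C > 0"
    and ev: "\<forall>\<^sub>F \<epsilon> in at_right 0. 0 < \<epsilon> \<and> (\<forall>_\<in>{()}. norm (f (scale \<epsilon> \<phi>)) \<le> C * \<epsilon> powi k)"
    by (rule order_boundE)
  from ev show "(\<lambda>\<epsilon>. norm (f (scale \<epsilon> \<phi>))) \<in> O[at_right 0](\<lambda>\<epsilon>. \<epsilon> powi k)"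
    by (intro landau_o.bigI[OF C]) (auto elim!: eventually_mono simp: power_int_abs)
qed

text \<open>Boundedness is needed because the supremum of an unbounded set of reals is an unspecified number
  and bounds nothing.\<close>

lemma sup_norm_on_bigo_iff_order_bound:
  assumes "\<forall>\<^sub>F \<epsilon> in at_right 0. bdd_above ((\<lambda>x. cmod (F (scale \<epsilon> \<phi>) x)) ` K)"
  shows "(\<lambda>\<epsilon>. sup_norm_on K (F (scale \<epsilon> \<phi>))) \<in> O[at_right 0](\<lambda>\<epsilon>. \<epsilon> powi k) \<longleftrightarrow> order_bound K k F \<phi>"
proof
  assume "(\<lambda>\<epsilon>. sup_norm_on K (F (scale \<epsilon> \<phi>))) \<in> O[at_right 0](\<lambda>\<epsilon>. \<epsilon> powi k)"
  then obtain C where "\<forall>\<^sub>F \<epsilon> in at_right 0. norm (sup_norm_on K (F (scale \<epsilon> \<phi>))) \<le> C * norm (\<epsilon> powi k)"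
    by (rule landau_o.bigE)
  then have "\<forall>\<^sub>F \<epsilon> in at_right 0. \<forall>x\<in>K. cmod (F (scale \<epsilon> \<phi>) x) \<le> C * \<epsilon> powi k"
    using eventually_at_right_less[of 0] assms
  proof eventually_elim
    case (elim \<epsilon>)
    show ?case
    proof
      fix x assume x: "x \<in> K"
      have "cmod (F (scale \<epsilon> \<phi>) x) \<le> (SUP x\<in>K. cmod (F (scale \<epsilon> \<phi>) x))"
        by (rule cSUP_upper[OF x elim(3)])
      also have "\<dots> = sup_norm_on K (F (scale \<epsilon> \<phi>))" using x by (auto simp: sup_norm_on_def)
      finally show "cmod (F (scale \<epsilon> \<phi>) x) \<le> C * \<epsilon> powi k"
        using elim(1,2) by (simp add: power_int_abs)
    qed
  qed
  then show "order_bound K k F \<phi>" by (auto simp: order_bound_def)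
next
  assume "order_bound K k F \<phi>"
  then obtain C where C: "C > 0"
    and ev: "\<forall>\<^sub>F \<epsilon> in at_right 0. 0 < \<epsilon> \<and> (\<forall>x\<in>K. cmod (F (scale \<epsilon> \<phi>) x) \<le> C * \<epsilon> powi k)"
    by (rule order_boundE)
  from ev assms have "\<forall>\<^sub>F \<epsilon> in at_right 0. norm (sup_norm_on K (F (scale \<epsilon> \<phi>))) \<le> C * norm (\<epsilon> powi k)"
  proof eventually_elim
    case (elim \<epsilon>)
    show ?case
    proof (cases "K = {}")
      case True
      then show ?thesis using C by (simp add: sup_norm_on_def)
    next
      case False
      then obtain x where x: "x \<in> K" by blast
      have "(SUP x\<in>K. cmod (F (scale \<epsilon> \<phi>) x)) \<le> C * \<epsilon> powi k"
        by (rule cSUP_least[OF False]) (use elim in blast)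
      moreover have "0 \<le> (SUP x\<in>K. cmod (F (scale \<epsilon> \<phi>) x))"
        by (rule order_trans[OF norm_ge_zero cSUP_upper[OF x elim(2)]])
      ultimately show ?thesis using False elim(1) by (simp add: sup_norm_on_def power_int_abs)
    qed
  qed
  then show "(\<lambda>\<epsilon>. sup_norm_on K (F (scale \<epsilon> \<phi>))) \<in> O[at_right 0](\<lambda>\<epsilon>. \<epsilon> powi k)"
    by (rule landau_o.bigI[OF C])
qed

section \<open>Growth of derivatives\<close>

type_synonym 'n family = "(real^'n \<Rightarrow> complex) \<Rightarrow> real^'n \<Rightarrow> complex"

text \<open>Quantifying over all sublists of a list of directions gives a notion that obeys the recursion
  \<open>all_derivs_Cons\<close>. Estimates for products and reciprocals then follow by induction
  on the list: the first derivative is computed by the product rule, and the induction hypothesis covers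
  the terms that arise.\<close>

definition all_derivs :: "('n::finite family \<Rightarrow> bool) \<Rightarrow> 'n list \<Rightarrow> 'n family \<Rightarrow> bool" where
  "all_derivs P is F \<longleftrightarrow> (\<forall>js. subseq js is \<longrightarrow> P (\<lambda>\<psi>. fold partial_deriv js (F \<psi>)))"

lemma subseq_Nil_right_iff: "subseq js [] \<longleftrightarrow> js = []"
  by (cases js) auto

lemma subseq_Cons_right_iff:
  "subseq js (i # is) \<longleftrightarrow> subseq js is \<or> (\<exists>js'. js = i # js' \<and> subseq js' is)"
proof (cases js)
  case (Cons j js')
  then show ?thesis using subseq_Cons'[of j js' "is"] by (cases "j = i") auto
qed simp

lemma all_derivs_Nil [simp]: "all_derivs P [] F \<longleftrightarrow> P F"
  by (simp add: all_derivs_def subseq_Nil_right_iff)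

lemma all_derivs_Cons [simp]:
  "all_derivs P (i # is) F \<longleftrightarrow> all_derivs P is F \<and> all_derivs P is (\<lambda>\<psi>. partial_deriv i (F \<psi>))"
proof -
  have *: "(\<forall>js. (\<exists>js'. js = i # js' \<and> A js') \<longrightarrow> Q js) \<longleftrightarrow> (\<forall>js'. A js' \<longrightarrow> Q (i # js'))"
    for A Q :: "'a list \<Rightarrow> bool" by blast
  have "all_derivs P (i # is) F \<longleftrightarrow>
      all_derivs P is F \<and> (\<forall>js. subseq js is \<longrightarrow> P (\<lambda>\<psi>. fold partial_deriv (i # js) (F \<psi>)))"
    unfolding all_derivs_def subseq_Cons_right_iff imp_disjL all_conj_distrib * ..
  then show ?thesis by (simp add: all_derivs_def)
qed

lemma all_derivs_self: "all_derivs P is F \<Longrightarrow> P F"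
  by (induction "is") auto

definition smooth_family :: "(real^'n::finite) set \<Rightarrow> 'n family \<Rightarrow> bool" where
  "smooth_family \<Omega> F \<longleftrightarrow> (\<forall>\<psi>\<in>\<A> 0. smooth_on (slice \<Omega> \<psi>) (F \<psi>))"

definition eq_on_slices :: "(real^'n::finite) set \<Rightarrow> 'n family \<Rightarrow> 'n family \<Rightarrow> bool" where
  "eq_on_slices \<Omega> F G \<longleftrightarrow> (\<forall>\<psi>\<in>\<A> 0. \<forall>x\<in>slice \<Omega> \<psi>. F \<psi> x = G \<psi> x)"

lemma smooth_family_partial_deriv:
  "smooth_family \<Omega> F \<Longrightarrow> smooth_family \<Omega> (\<lambda>\<psi>. partial_deriv i (F \<psi>))"
  by (simp add: smooth_family_def smooth_on_partial_deriv)

lemma smooth_family_differentiable: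
  assumes "open \<Omega>" "smooth_family \<Omega> F" "\<psi> \<in> \<A> 0" "x \<in> slice \<Omega> \<psi>"
  shows "F \<psi> differentiable at x"
  using smooth_on_imp_differentiable_on[of "slice \<Omega> \<psi>" "F \<psi>"] assms open_slice[OF assms(1), of \<psi>]
  by (simp add: smooth_family_def differentiable_on_eq_differentiable_at)

lemma smooth_family_cong:
  assumes "open \<Omega>" "eq_on_slices \<Omega> F G" "smooth_family \<Omega> F"
  shows "smooth_family \<Omega> G"
  unfolding smooth_family_def
proof
  fix \<psi> :: "real^'a \<Rightarrow> complex" assume "\<psi> \<in> \<A> 0"
  then show "smooth_on (slice \<Omega> \<psi>) (G \<psi>)"
    using assms smooth_on_cong[OF open_slice[OF assms(1)], of \<psi> "F \<psi>" "G \<psi>"]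
    by (simp add: eq_on_slices_def smooth_family_def)
qed

lemma smooth_family_const: "smooth_family \<Omega> (\<lambda>\<psi> x. c \<psi>)"
  by (simp add: smooth_family_def smooth_on_const)

lemma smooth_family_add:
  "open \<Omega> \<Longrightarrow> smooth_family \<Omega> F \<Longrightarrow> smooth_family \<Omega> G \<Longrightarrow> smooth_family \<Omega> (\<lambda>\<psi> x. F \<psi> x + G \<psi> x)"
  by (simp add: smooth_family_def smooth_on_add open_slice)

lemma smooth_family_mult:
  "open \<Omega> \<Longrightarrow> smooth_family \<Omega> F \<Longrightarrow> smooth_family \<Omega> G \<Longrightarrow> smooth_family \<Omega> (\<lambda>\<psi> x. F \<psi> x * G \<psi> x)"
  by (simp add: smooth_family_def smooth_on_mult open_slice)

lemma smooth_family_cnj: "open \<Omega> \<Longrightarrow> smooth_family \<Omega> F \<Longrightarrow> smooth_family \<Omega> (\<lambda>\<psi> x. cnj (F \<psi> x))"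
  by (simp add: smooth_family_def smooth_on_cnj open_slice)

lemma smooth_family_inverse:
  assumes "open \<Omega>" "smooth_family \<Omega> F" "\<And>\<psi> x. \<psi> \<in> \<A> 0 \<Longrightarrow> x \<in> slice \<Omega> \<psi> \<Longrightarrow> F \<psi> x \<noteq> 0"
  shows "smooth_family \<Omega> (\<lambda>\<psi> x. inverse (F \<psi> x))"
  using assms by (simp add: smooth_family_def smooth_on_inverse open_slice)

text \<open>Moderateness and negligibility on a compact set share the closure properties that the induction on
  derivatives uses, so \<open>P\<close> stands for either of them.\<close>

locale compact_in_open =
  fixes \<Omega> K :: "(real^'n::finite) set" and P :: "'n family \<Rightarrow> bool"
  assumes open_\<Omega>: "open \<Omega>" and compact_K: "compact K" and K_subset: "K \<subseteq> \<Omega>"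
    and P: "P \<in> {moderate_on K, negligible_on K}"
begin

lemma P_cong:
  assumes "eq_on_slices \<Omega> F G" "P F"
  shows "P G"
proof -
  have "\<forall>\<phi>\<in>\<A> 0. \<forall>\<^sub>F \<epsilon> in at_right 0. \<forall>x\<in>K. \<exists>y\<in>K. norm (G (scale \<epsilon> \<phi>) x) \<le> norm (F (scale \<epsilon> \<phi>) y)"
  proof
    fix \<phi> :: "real^'n \<Rightarrow> complex" assume \<phi>: "\<phi> \<in> \<A> 0"
    show "\<forall>\<^sub>F \<epsilon> in at_right 0. \<forall>x\<in>K. \<exists>y\<in>K. norm (G (scale \<epsilon> \<phi>) x) \<le> norm (F (scale \<epsilon> \<phi>) y)"
      using eventually_subset_slice[OF open_\<Omega> compact_K K_subset \<phi>] eventually_scale_moment_functions[OF \<phi>]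
    proof eventually_elim
      case (elim \<epsilon>)
      then have "F (scale \<epsilon> \<phi>) x = G (scale \<epsilon> \<phi>) x" if "x \<in> K" for x
        using assms(1) that by (auto simp: eq_on_slices_def)
      then show ?case by force
    qed
  qed
  then show ?thesis using assms(2) P moderate_transfer[of K F 0 K G] negligible_transfer[of K F 0 K G] by auto
qed

lemma P_add: "P F \<Longrightarrow> P G \<Longrightarrow> P (\<lambda>\<psi> x. F \<psi> x + G \<psi> x)"
  using P moderate_add[of K F G] negligible_add[of K F G] by auto

lemma P_mult: "P F \<Longrightarrow> moderate_on K G \<Longrightarrow> P (\<lambda>\<psi> x. F \<psi> x * G \<psi> x)"
  using P moderate_mult[of K F G] negligible_mult[of K F G] by auto

lemma P_zero: "P (\<lambda>\<psi> x. 0)"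
  using P moderate_const[of K 0] negligible_zero[of K] by auto

lemma P_cnj: 
  assumes "P F" shows "P (\<lambda>\<psi> x. cnj (F \<psi> x))"
proof -
  have "\<forall>\<phi>\<in>\<A> 0. \<forall>\<^sub>F \<epsilon> in at_right 0. \<forall>x\<in>K. \<exists>y\<in>K. norm (cnj (F (scale \<epsilon> \<phi>) x)) \<le> norm (F (scale \<epsilon> \<phi>) y)"
    by (auto intro!: always_eventually)
  then show ?thesis
    using assms P moderate_transfer[of K F 0 K "\<lambda>\<psi> x. cnj (F \<psi> x)"]
      negligible_transfer[of K F 0 K "\<lambda>\<psi> x. cnj (F \<psi> x)"] by auto
qed

lemma all_derivs_cong:
  assumes "eq_on_slices \<Omega> F G" "all_derivs P is F"
  shows "all_derivs P is G"
  unfolding all_derivs_def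
proof (intro allI impI)
  fix js assume "subseq js is"
  then have "P (\<lambda>\<psi>. fold partial_deriv js (F \<psi>))" using assms(2) by (simp add: all_derivs_def)
  moreover have "eq_on_slices \<Omega> (\<lambda>\<psi>. fold partial_deriv js (F \<psi>)) (\<lambda>\<psi>. fold partial_deriv js (G \<psi>))"
    unfolding eq_on_slices_def
  proof (intro ballI)
    fix \<psi> :: "real^'n \<Rightarrow> complex" and x assume "\<psi> \<in> \<A> 0" "x \<in> slice \<Omega> \<psi>"
    then show "fold partial_deriv js (F \<psi>) x = fold partial_deriv js (G \<psi>) x"
      using assms(1) by (intro iterated_partial_deriv_cong[OF open_slice[OF open_\<Omega>]]) (auto simp: eq_on_slices_def)
  qed
  ultimately show "P (\<lambda>\<psi>. fold partial_deriv js (G \<psi>))" by (rule P_cong[rotated])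
qed

lemma all_derivs_const:
  assumes "P (\<lambda>\<psi> x. c \<psi>)"
  shows "all_derivs P is (\<lambda>\<psi> x. c \<psi>)"
  using assms
proof (induction "is" arbitrary: c)
  case (Cons i "is")
  then show ?case using Cons.IH[of "\<lambda>\<psi>. 0"] P_zero by (simp add: partial_deriv_const)
qed simp

lemma all_derivs_add:
  assumes "smooth_family \<Omega> F" "smooth_family \<Omega> G" "all_derivs P is F" "all_derivs P is G"
  shows "all_derivs P is (\<lambda>\<psi> x. F \<psi> x + G \<psi> x)"
  using assms
proof (induction "is" arbitrary: F G)
  case Nil
  then show ?case by (simp add: P_add)
next
  case (Cons i "is")
  have "all_derivs P is (\<lambda>\<psi> x. partial_deriv i (F \<psi>) x + partial_deriv i (G \<psi>) x)"
    using Cons.prems by (intro Cons.IH smooth_family_partial_deriv) auto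
  moreover have "eq_on_slices \<Omega> (\<lambda>\<psi> x. partial_deriv i (F \<psi>) x + partial_deriv i (G \<psi>) x)
      (\<lambda>\<psi>. partial_deriv i (\<lambda>x. F \<psi> x + G \<psi> x))"
    using Cons.prems(1,2)[THEN smooth_family_differentiable[OF open_\<Omega>]]
    by (simp add: eq_on_slices_def partial_deriv_add)
  ultimately have "all_derivs P is (\<lambda>\<psi>. partial_deriv i (\<lambda>x. F \<psi> x + G \<psi> x))"
    by (rule all_derivs_cong[rotated])
  moreover have "all_derivs P is (\<lambda>\<psi> x. F \<psi> x + G \<psi> x)"
    using Cons.prems by (intro Cons.IH) auto
  ultimately show ?case by simp
qed

lemma all_derivs_mult:
  assumes "smooth_family \<Omega> F" "smooth_family \<Omega> G" "all_derivs P is F" "all_derivs (moderate_on K) is G"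
  shows "all_derivs P is (\<lambda>\<psi> x. F \<psi> x * G \<psi> x)"
  using assms
proof (induction "is" arbitrary: F G)
  case Nil
  then show ?case by (simp add: P_mult)
next
  case (Cons i "is")
  have "all_derivs P is (\<lambda>\<psi> x. partial_deriv i (F \<psi>) x * G \<psi> x)"
    "all_derivs P is (\<lambda>\<psi> x. F \<psi> x * partial_deriv i (G \<psi>) x)"
    using Cons.prems by (auto intro!: Cons.IH smooth_family_partial_deriv)
  then have "all_derivs P is
      (\<lambda>\<psi> x. partial_deriv i (F \<psi>) x * G \<psi> x + F \<psi> x * partial_deriv i (G \<psi>) x)"
    using Cons.prems(1,2)
    by (intro all_derivs_add smooth_family_mult[OF open_\<Omega>] smooth_family_partial_deriv)
  moreover have "eq_on_slices \<Omega>
      (\<lambda>\<psi> x. partial_deriv i (F \<psi>) x * G \<psi> x + F \<psi> x * partial_deriv i (G \<psi>) x)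
      (\<lambda>\<psi>. partial_deriv i (\<lambda>x. F \<psi> x * G \<psi> x))"
    using Cons.prems(1,2)[THEN smooth_family_differentiable[OF open_\<Omega>]]
    by (simp add: eq_on_slices_def partial_deriv_mult)
  ultimately have "all_derivs P is (\<lambda>\<psi>. partial_deriv i (\<lambda>x. F \<psi> x * G \<psi> x))"
    by (rule all_derivs_cong[rotated])
  moreover have "all_derivs P is (\<lambda>\<psi> x. F \<psi> x * G \<psi> x)"
    using Cons.prems by (intro Cons.IH) auto
  ultimately show ?case by simp
qed

lemma all_derivs_cnj:
  assumes "smooth_family \<Omega> F" "all_derivs P is F"
  shows "all_derivs P is (\<lambda>\<psi> x. cnj (F \<psi> x))"
  using assms
proof (induction "is" arbitrary: F)
  case Nil
  then show ?case by (simp add: P_cnj)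
next
  case (Cons i "is")
  have "all_derivs P is (\<lambda>\<psi> x. cnj (partial_deriv i (F \<psi>) x))"
    using Cons.prems by (intro Cons.IH smooth_family_partial_deriv) auto
  moreover have "eq_on_slices \<Omega> (\<lambda>\<psi> x. cnj (partial_deriv i (F \<psi>) x)) (\<lambda>\<psi>. partial_deriv i (\<lambda>x. cnj (F \<psi> x)))"
    using smooth_family_differentiable[OF open_\<Omega> Cons.prems(1)]
    by (simp add: eq_on_slices_def partial_deriv_cnj)
  ultimately have "all_derivs P is (\<lambda>\<psi>. partial_deriv i (\<lambda>x. cnj (F \<psi> x)))"
    by (rule all_derivs_cong[rotated])
  moreover have "all_derivs P is (\<lambda>\<psi> x. cnj (F \<psi> x))"
    using Cons.prems by (intro Cons.IH) auto
  ultimately show ?case by simp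
qed

end

text \<open>From \<open>\<partial>(1/F) = - \<partial>F (1/F) (1/F)\<close>: each further derivative of \<open>1/F\<close> is a product of a
  derivative of \<open>F\<close> and of derivatives of \<open>1/F\<close> of lower order, and the bound on \<open>1/F\<close> itself starts
  the induction.\<close>

lemma all_derivs_inverse:
  fixes \<Omega> K :: "(real^'n::finite) set"
  assumes "open \<Omega>" "compact K" "K \<subseteq> \<Omega>" and sm: "smooth_family \<Omega> F"
    and nz: "\<And>\<psi> x. \<psi> \<in> \<A> 0 \<Longrightarrow> x \<in> slice \<Omega> \<psi> \<Longrightarrow> F \<psi> x \<noteq> 0"
    and "all_derivs (moderate_on K) is F" and inv: "moderate_on K (\<lambda>\<psi> x. inverse (F \<psi> x))"
  shows "all_derivs (moderate_on K) is (\<lambda>\<psi> x. inverse (F \<psi> x))"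
proof -
  interpret compact_in_open \<Omega> K "moderate_on K" using assms(1-3) by unfold_locales auto
  note smi = smooth_family_inverse[OF assms(1) sm nz]
  show ?thesis using assms(6)
  proof (induction "is")
    case Nil
    then show ?case by (simp add: inv)
  next
    case (Cons i "is")
    have IH: "all_derivs (moderate_on K) is (\<lambda>\<psi> x. inverse (F \<psi> x))" using Cons by simp
    have "all_derivs (moderate_on K) is
        (\<lambda>\<psi> x. - 1 * (partial_deriv i (F \<psi>) x * (inverse (F \<psi> x) * inverse (F \<psi> x))))"
      using Cons.prems IH
      by (intro all_derivs_mult smooth_family_mult[OF assms(1)] smi sm smooth_family_partial_deriv
          smooth_family_const all_derivs_const moderate_const) auto
    moreover have "eq_on_slices \<Omega>
        (\<lambda>\<psi> x. - 1 * (partial_deriv i (F \<psi>) x * (inverse (F \<psi> x) * inverse (F \<psi> x))))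
        (\<lambda>\<psi>. partial_deriv i (\<lambda>x. inverse (F \<psi> x)))"
      using smooth_family_differentiable[OF assms(1) sm] nz
      by (simp add: eq_on_slices_def partial_deriv_inverse)
    ultimately have "all_derivs (moderate_on K) is (\<lambda>\<psi>. partial_deriv i (\<lambda>x. inverse (F \<psi> x)))"
      by (rule all_derivs_cong[rotated])
    then show ?case using IH by simp
  qed
qed

text \<open>The list of directions along which \<^const>\<open>mi_deriv\<close> differentiates. Deleting entries of such a
  list gives the list of a smaller multi-index, so bounds along all \<open>mi_list \<alpha>\<close> include the bounds along
  their sublists that \<^const>\<open>all_derivs\<close> asks for.\<close>

definition mi_list :: "'n::finite multi_index \<Rightarrow> 'n list" where
  "mi_list \<alpha> = concat (map (\<lambda>i. replicate (\<alpha> i) i) coords)"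

lemma mi_deriv_eq_fold: "mi_deriv \<alpha> f = fold partial_deriv (mi_list \<alpha>) f"
proof -
  have "fold (\<lambda>i. partial_deriv i ^^ \<alpha> i) cs g
      = fold partial_deriv (concat (map (\<lambda>i. replicate (\<alpha> i) i) cs)) g" for cs g
    by (induction cs arbitrary: g) simp_all
  then show ?thesis by (simp add: mi_deriv_def mi_list_def)
qed

lemma distinct_set_coords: "distinct (coords :: 'n::finite list) \<and> set (coords :: 'n list) = UNIV"
proof -
  have "\<exists>is::'n list. distinct is \<and> set is = UNIV"
    using finite_distinct_list[OF finite[of UNIV]] by blast
  then show ?thesis unfolding coords_def by (rule someI_ex)
qed

lemma subseq_replicateD:
  assumes "subseq xs (replicate n x)"
  shows "xs = replicate (length xs) x"
  using list_emb_set[OF assms] by (intro replicate_eqI) auto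

lemma subseq_mi_list:
  assumes "subseq js (mi_list \<alpha>)"
  obtains \<beta> where "js = mi_list \<beta>"
proof -
  have "\<exists>\<beta>. js = concat (map (\<lambda>i. replicate (\<beta> i) i) cs)"
    if "distinct cs" "subseq js (concat (map (\<lambda>i. replicate (\<alpha> i) i) cs))" for cs
    using that
  proof (induction cs arbitrary: js)
    case (Cons c cs)
    from Cons.prems(2) obtain ks ls where js: "js = ks @ ls" "subseq ks (replicate (\<alpha> c) c)"
      "subseq ls (concat (map (\<lambda>i. replicate (\<alpha> i) i) cs))"
      by (auto elim: subseq_appendE)
    obtain \<beta> where \<beta>: "ls = concat (map (\<lambda>i. replicate (\<beta> i) i) cs)"
      using Cons.IH[OF _ js(3)] Cons.prems(1) by auto
    have "map (\<lambda>i. replicate ((\<beta>(c := length ks)) i) i) cs = map (\<lambda>i. replicate (\<beta> i) i) cs"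
      using Cons.prems(1) by (intro map_cong) auto
    then have "js = concat (map (\<lambda>i. replicate ((\<beta>(c := length ks)) i) i) (c # cs))"
      using js(1) \<beta> subseq_replicateD[OF js(2)] by (simp del: map_eq_conv fun_upd_apply add: fun_upd_same)
    then show ?case by blast
  qed simp
  from this[OF distinct_set_coords[THEN conjunct1]] show ?thesis using that assms unfolding mi_list_def by blast
qed

lemma all_derivs_mi_list:
  fixes F :: "'n::finite family"
  shows "(\<forall>\<alpha>. all_derivs P (mi_list \<alpha>) F) \<longleftrightarrow> (\<forall>\<alpha>. P (\<lambda>\<psi>. mi_deriv \<alpha> (F \<psi>)))"
proof
  assume L: "\<forall>\<alpha>. all_derivs P (mi_list \<alpha>) F"
  show "\<forall>\<alpha>. P (\<lambda>\<psi>. mi_deriv \<alpha> (F \<psi>))"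
  proof
    fix \<alpha>
    show "P (\<lambda>\<psi>. mi_deriv \<alpha> (F \<psi>))"
      using L unfolding all_derivs_def mi_deriv_eq_fold by blast
  qed
next
  assume R: "\<forall>\<alpha>. P (\<lambda>\<psi>. mi_deriv \<alpha> (F \<psi>))"
  show "\<forall>\<alpha>. all_derivs P (mi_list \<alpha>) F"
    unfolding all_derivs_def
  proof (intro allI impI)
    fix \<alpha> :: "'n multi_index" and js assume "subseq js (mi_list \<alpha>)"
    then obtain \<beta> where "js = mi_list \<beta>" by (rule subseq_mi_list)
    then show "P (\<lambda>\<psi>. fold partial_deriv js (F \<psi>))"
      using R by (simp add: mi_deriv_eq_fold)
  qed
qed

lemma mi_list_single: "mi_list (\<lambda>j. if j = i then 1 else 0) = [i]"
proof -
  have "concat (map (\<lambda>j. replicate (if j = i then 1 else 0) j) cs) = (if i \<in> set cs then [i] else [])"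
    if "distinct cs" for cs
    using that by (induction cs) auto
  from this[OF distinct_set_coords[THEN conjunct1]] show ?thesis by (simp add: mi_list_def distinct_set_coords)
qed

text \<open>Here \<open>T\<close> is \<open>moderate_on\<close> or \<open>negligible_on\<close>; the two choices describe the curried elements of
  the algebra of moderate functions and of its ideal of negligible functions.\<close>

definition growth_family ::
  "(real^'n::finite) set \<Rightarrow> ((real^'n) set \<Rightarrow> 'n family \<Rightarrow> bool) \<Rightarrow> 'n family \<Rightarrow> bool" where
  "growth_family \<Omega> T F \<longleftrightarrow> smooth_family \<Omega> F \<and>
    (\<forall>K \<alpha>. compact K \<and> K \<subseteq> \<Omega> \<longrightarrow> all_derivs (T K) (mi_list \<alpha>) F)"

lemma growth_familyD:
  "growth_family \<Omega> T F \<Longrightarrow> compact K \<Longrightarrow> K \<subseteq> \<Omega> \<Longrightarrow> T K F"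
  unfolding growth_family_def using all_derivs_self by blast

lemma growth_family_partial_derivD:
  assumes "growth_family \<Omega> T F" "compact K" "K \<subseteq> \<Omega>"
  shows "T K (\<lambda>\<psi>. partial_deriv i (F \<psi>))"
proof -
  have "all_derivs (T K) (mi_list (\<lambda>j. if j = i then 1 else 0)) F"
    using assms unfolding growth_family_def by blast
  then show ?thesis unfolding mi_list_single by simp
qed

lemma growth_family_cong:
  assumes "open \<Omega>" "T \<in> {moderate_on, negligible_on}" "eq_on_slices \<Omega> F G" "growth_family \<Omega> T F"
  shows "growth_family \<Omega> T G"
  unfolding growth_family_def
proof (intro conjI allI impI)
  show "smooth_family \<Omega> G" using assms smooth_family_cong unfolding growth_family_def by blast
  fix K \<alpha> assume K: "compact K \<and> K \<subseteq> \<Omega>"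
  interpret compact_in_open \<Omega> K "T K" using assms(1,2) K by unfold_locales auto
  show "all_derivs (T K) (mi_list \<alpha>) G"
    using assms(4) K by (intro all_derivs_cong[OF assms(3)]) (simp add: growth_family_def)
qed

lemma growth_family_const:
  assumes "open \<Omega>" "T \<in> {moderate_on, negligible_on}"
    and "\<And>K. compact K \<Longrightarrow> K \<subseteq> \<Omega> \<Longrightarrow> T K (\<lambda>\<psi> x. c \<psi>)"
  shows "growth_family \<Omega> T (\<lambda>\<psi> x. c \<psi>)"
  unfolding growth_family_def
proof (intro conjI allI impI)
  fix K \<alpha> assume K: "compact K \<and> K \<subseteq> \<Omega>"
  interpret compact_in_open \<Omega> K "T K" using assms(1,2) K by unfold_locales auto
  show "all_derivs (T K) (mi_list \<alpha>) (\<lambda>\<psi> x. c \<psi>)" using assms(3) K by (intro all_derivs_const) auto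
qed (rule smooth_family_const)

lemma growth_family_add:
  assumes "open \<Omega>" "T \<in> {moderate_on, negligible_on}" "growth_family \<Omega> T F" "growth_family \<Omega> T G"
  shows "growth_family \<Omega> T (\<lambda>\<psi> x. F \<psi> x + G \<psi> x)"
  unfolding growth_family_def
proof (intro conjI allI impI)
  show "smooth_family \<Omega> (\<lambda>\<psi> x. F \<psi> x + G \<psi> x)"
    using assms smooth_family_add unfolding growth_family_def by blast
  fix K \<alpha> assume K: "compact K \<and> K \<subseteq> \<Omega>"
  interpret compact_in_open \<Omega> K "T K" using assms(1,2) K by unfold_locales auto
  show "all_derivs (T K) (mi_list \<alpha>) (\<lambda>\<psi> x. F \<psi> x + G \<psi> x)"
    using assms(3,4) K by (intro all_derivs_add) (auto simp: growth_family_def)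
qed

lemma growth_family_mult:
  assumes "open \<Omega>" "T \<in> {moderate_on, negligible_on}" "growth_family \<Omega> T F" "growth_family \<Omega> moderate_on G"
  shows "growth_family \<Omega> T (\<lambda>\<psi> x. F \<psi> x * G \<psi> x)"
  unfolding growth_family_def
proof (intro conjI allI impI)
  show "smooth_family \<Omega> (\<lambda>\<psi> x. F \<psi> x * G \<psi> x)"
    using assms smooth_family_mult unfolding growth_family_def by blast
  fix K \<alpha> assume K: "compact K \<and> K \<subseteq> \<Omega>"
  interpret compact_in_open \<Omega> K "T K" using assms(1,2) K by unfold_locales auto
  show "all_derivs (T K) (mi_list \<alpha>) (\<lambda>\<psi> x. F \<psi> x * G \<psi> x)"
    using assms(3,4) K by (intro all_derivs_mult) (auto simp: growth_family_def)
qed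

lemma growth_family_cnj:
  assumes "open \<Omega>" "T \<in> {moderate_on, negligible_on}" "growth_family \<Omega> T F"
  shows "growth_family \<Omega> T (\<lambda>\<psi> x. cnj (F \<psi> x))"
  unfolding growth_family_def
proof (intro conjI allI impI)
  show "smooth_family \<Omega> (\<lambda>\<psi> x. cnj (F \<psi> x))"
    using assms smooth_family_cnj unfolding growth_family_def by blast
  fix K \<alpha> assume K: "compact K \<and> K \<subseteq> \<Omega>"
  interpret compact_in_open \<Omega> K "T K" using assms(1,2) K by unfold_locales auto
  show "all_derivs (T K) (mi_list \<alpha>) (\<lambda>\<psi> x. cnj (F \<psi> x))"
    using assms(3) K by (intro all_derivs_cnj) (auto simp: growth_family_def)
qed

lemma moderate_family_inverse:
  assumes "open \<Omega>" "growth_family \<Omega> moderate_on F"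
    and nz: "\<And>\<psi> x. \<psi> \<in> \<A> 0 \<Longrightarrow> x \<in> slice \<Omega> \<psi> \<Longrightarrow> F \<psi> x \<noteq> 0"
    and inv: "\<And>K. compact K \<Longrightarrow> K \<subseteq> \<Omega> \<Longrightarrow> moderate_on K (\<lambda>\<psi> x. inverse (F \<psi> x))"
  shows "growth_family \<Omega> moderate_on (\<lambda>\<psi> x. inverse (F \<psi> x))"
  unfolding growth_family_def
proof (intro conjI allI impI)
  have sm: "smooth_family \<Omega> F" using assms(2) by (simp add: growth_family_def)
  then show "smooth_family \<Omega> (\<lambda>\<psi> x. inverse (F \<psi> x))"
    by (rule smooth_family_inverse[OF assms(1) _ nz])
  fix K \<alpha> assume K: "compact K \<and> K \<subseteq> \<Omega>"
  then have "all_derivs (moderate_on K) (mi_list \<alpha>) F" using assms(2) by (simp add: growth_family_def)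
  then show "all_derivs (moderate_on K) (mi_list \<alpha>) (\<lambda>\<psi> x. inverse (F \<psi> x))"
    using K by (intro all_derivs_inverse[OF assms(1) _ _ sm nz _ inv]) auto
qed

lemma negligible_family_imp_moderate_family:
  "growth_family \<Omega> negligible_on F \<Longrightarrow> growth_family \<Omega> moderate_on F"
  unfolding growth_family_def all_derivs_def using negligible_imp_moderate by blast

section \<open>The rings of generalized functions and numbers\<close>

lemma E_e_iff: "R \<in> E_e \<Omega> \<longleftrightarrow> R \<in> extensional (U_set \<Omega>) \<and> smooth_family \<Omega> (curry R)"
  by (auto simp: E_e_def smooth_family_def slice_def curry_def PiE_def)

lemma sup_norm_mi_deriv_bigo_iff_order_bound:
  assumes "open \<Omega>" "R \<in> E_e \<Omega>" "compact K" "K \<subseteq> \<Omega>" "\<phi> \<in> \<A> 0"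
  shows "(\<lambda>\<epsilon>. sup_norm_on K (mi_deriv \<alpha> (\<lambda>x. R (scale \<epsilon> \<phi>, x)))) \<in> O[at_right 0](\<lambda>\<epsilon>. \<epsilon> powi k)
    \<longleftrightarrow> order_bound K k (\<lambda>\<psi>. mi_deriv \<alpha> (curry R \<psi>)) \<phi>"
proof -
  have "\<forall>\<^sub>F \<epsilon> in at_right 0. bdd_above ((\<lambda>x. cmod (mi_deriv \<alpha> (curry R (scale \<epsilon> \<phi>)) x)) ` K)"
    using eventually_subset_slice[OF assms(1,3,4,5)] eventually_scale_moment_functions[OF assms(5)]
  proof eventually_elim
    case (elim \<epsilon>)
    then have "smooth_on (slice \<Omega> (scale \<epsilon> \<phi>)) (mi_deriv \<alpha> (curry R (scale \<epsilon> \<phi>)))"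
      using assms(2) by (simp add: E_e_iff smooth_family_def mi_deriv_eq_fold smooth_on_iterated_partial_deriv)
    then have "continuous_on K (mi_deriv \<alpha> (curry R (scale \<epsilon> \<phi>)))"
      using elim(1) smooth_on_imp_continuous_on continuous_on_subset by blast
    then have "continuous_on K (\<lambda>x. cmod (mi_deriv \<alpha> (curry R (scale \<epsilon> \<phi>)) x))"
      by (rule continuous_on_norm)
    then show ?case
      using assms(3) by (simp add: bounded_imp_bdd_above compact_continuous_image compact_imp_bounded)
  qed
  from sup_norm_on_bigo_iff_order_bound[of "\<lambda>\<psi>. mi_deriv \<alpha> (curry R \<psi>)", OF this, of k]
  show ?thesis by (simp add: curry_def)
qed

lemma E_M_iff:
  assumes "open \<Omega>"
  shows "R \<in> E_M \<Omega> \<longleftrightarrow> R \<in> extensional (U_set \<Omega>) \<and> growth_family \<Omega> moderate_on (curry R)"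
proof -
  have "(\<exists>N\<ge>1. \<forall>\<phi>\<in>\<A> N. (\<lambda>\<epsilon>. sup_norm_on K (mi_deriv \<alpha> (\<lambda>x. R (scale \<epsilon> \<phi>, x))))
          \<in> O[at_right 0](\<lambda>\<epsilon>. 1 / \<epsilon> ^ N)) \<longleftrightarrow> moderate_on K (\<lambda>\<psi>. mi_deriv \<alpha> (curry R \<psi>))"
    if "compact K \<and> K \<subseteq> \<Omega>" "R \<in> E_e \<Omega>" for K \<alpha>
    by (rule moderate_iff_bigo) (use sup_norm_mi_deriv_bigo_iff_order_bound assms that in blast)
  then have "R \<in> E_M \<Omega> \<longleftrightarrow> R \<in> E_e \<Omega> \<and>
      (\<forall>K. compact K \<and> K \<subseteq> \<Omega> \<longrightarrow> (\<forall>\<alpha>. moderate_on K (\<lambda>\<psi>. mi_deriv \<alpha> (curry R \<psi>))))"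
    unfolding E_M_def by auto
  also have "\<dots> \<longleftrightarrow> R \<in> extensional (U_set \<Omega>) \<and> growth_family \<Omega> moderate_on (curry R)"
    unfolding all_derivs_mi_list[symmetric] E_e_iff growth_family_def by auto
  finally show ?thesis .
qed

lemma N_e_iff:
  assumes "open \<Omega>"
  shows "R \<in> N_e \<Omega> \<longleftrightarrow> R \<in> extensional (U_set \<Omega>) \<and> growth_family \<Omega> negligible_on (curry R)"
proof -
  have "(\<forall>m\<ge>1. \<exists>q\<ge>1. \<forall>\<phi>\<in>\<A> q. (\<lambda>\<epsilon>. sup_norm_on K (mi_deriv \<alpha> (\<lambda>x. R (scale \<epsilon> \<phi>, x))))
          \<in> O[at_right 0](\<lambda>\<epsilon>. \<epsilon> ^ m)) \<longleftrightarrow> negligible_on K (\<lambda>\<psi>. mi_deriv \<alpha> (curry R \<psi>))"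
    if "compact K \<and> K \<subseteq> \<Omega>" "R \<in> E_e \<Omega>" for K \<alpha>
    by (rule negligible_iff_bigo) (use sup_norm_mi_deriv_bigo_iff_order_bound assms that in blast)
  then have "R \<in> N_e \<Omega> \<longleftrightarrow> R \<in> E_e \<Omega> \<and>
      (\<forall>K. compact K \<and> K \<subseteq> \<Omega> \<longrightarrow> (\<forall>\<alpha>. negligible_on K (\<lambda>\<psi>. mi_deriv \<alpha> (curry R \<psi>))))"
    unfolding N_e_def by auto
  also have "\<dots> \<longleftrightarrow> R \<in> extensional (U_set \<Omega>) \<and> growth_family \<Omega> negligible_on (curry R)"
    unfolding all_derivs_mi_list[symmetric] E_e_iff growth_family_def by auto
  finally show ?thesis .
qed

lemma C_M_iff: "r \<in> C_M \<longleftrightarrow> r \<in> extensional (\<A> 0) \<and> moderate_on {()} (\<lambda>\<psi> _. r \<psi>)"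
  using moderate_iff_bigo[of "\<lambda>\<phi> \<epsilon>. cmod (r (scale \<epsilon> \<phi>))" "{()}" "\<lambda>\<psi> _. r \<psi>"]
  by (simp add: C_M_def PiE_def norm_bigo_iff_order_bound)

lemma C_N_iff: "r \<in> C_N \<longleftrightarrow> r \<in> extensional (\<A> 0) \<and> negligible_on {()} (\<lambda>\<psi> _. r \<psi>)"
  using negligible_iff_bigo[of "\<lambda>\<phi> \<epsilon>. cmod (r (scale \<epsilon> \<phi>))" "{()}" "\<lambda>\<psi> _. r \<psi>"]
  by (simp add: C_N_def PiE_def norm_bigo_iff_order_bound)

lemma pointwise_ring_cring:
  assumes ext: "F \<subseteq> extensional D"
    and zero: "(\<lambda>p\<in>D. 0) \<in> F" and one: "(\<lambda>p\<in>D. 1) \<in> F"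
    and add: "\<And>f g. f \<in> F \<Longrightarrow> g \<in> F \<Longrightarrow> (\<lambda>p\<in>D. f p + g p) \<in> F"
    and mult: "\<And>f g. f \<in> F \<Longrightarrow> g \<in> F \<Longrightarrow> (\<lambda>p\<in>D. f p * g p) \<in> F"
    and uminus: "\<And>f. f \<in> F \<Longrightarrow> (\<lambda>p\<in>D. - f p) \<in> F"
  shows "cring (pointwise_ring D F)"
proof (rule cringI)
  have undef: "f p = undefined" if "f \<in> F" "p \<notin> D" for f p
    using that ext by (auto intro: extensional_arb)
  show "abelian_group (pointwise_ring D F)"
  proof (rule abelian_groupI)
    fix f assume f: "f \<in> carrier (pointwise_ring D F)"
    show "\<exists>g\<in>carrier (pointwise_ring D F).
        g \<oplus>\<^bsub>pointwise_ring D F\<^esub> f = \<zero>\<^bsub>pointwise_ring D F\<^esub>"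
      using f uminus[of f] by (intro bexI[of _ "\<lambda>p\<in>D. - f p"]) (auto simp: pointwise_ring_def restrict_def)
  qed (use zero add in \<open>auto simp: pointwise_ring_def restrict_def fun_eq_iff undef\<close>)
  show "comm_monoid (pointwise_ring D F)"
    by (rule comm_monoidI) (use one mult in \<open>auto simp: pointwise_ring_def restrict_def fun_eq_iff undef\<close>)
qed (auto simp: pointwise_ring_def restrict_def fun_eq_iff distrib_right)

text \<open>Absorption of products also provides additive inverses, since \<open>- f\<close> is the product of \<open>f\<close> with the
  additive inverse of one.\<close>

lemma pointwise_ring_ideal:
  assumes cring: "cring (pointwise_ring D F)" and sub: "I \<subseteq> F" and zero: "(\<lambda>p\<in>D. 0) \<in> I"
    and add: "\<And>f g. f \<in> I \<Longrightarrow> g \<in> I \<Longrightarrow> (\<lambda>p\<in>D. f p + g p) \<in> I"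
    and mult: "\<And>f g. f \<in> I \<Longrightarrow> g \<in> F \<Longrightarrow> (\<lambda>p\<in>D. f p * g p) \<in> I"
  shows "ideal I (pointwise_ring D F)"
proof -
  let ?R = "pointwise_ring D F"
  interpret cring ?R by (rule cring)
  have mult_closed: "f \<otimes>\<^bsub>?R\<^esub> g \<in> I" if "f \<in> I" "g \<in> carrier ?R" for f g
    using mult that by (simp add: pointwise_ring_def)
  show ?thesis
  proof (rule idealI)
    show "ring ?R" by (rule ring_axioms)
    show "subgroup I (add_monoid ?R)"
    proof (rule add.subgroupI)
      show "I \<subseteq> carrier ?R" using sub by (simp add: pointwise_ring_def)
      show "I \<noteq> {}" using zero by blast
      fix f assume f: "f \<in> I"
      then have fc: "f \<in> carrier ?R" using sub by (auto simp: pointwise_ring_def)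
      have "\<ominus>\<^bsub>?R\<^esub> f = f \<otimes>\<^bsub>?R\<^esub> (\<ominus>\<^bsub>?R\<^esub> \<one>\<^bsub>?R\<^esub>)" using fc by algebra
      then show "\<ominus>\<^bsub>?R\<^esub> f \<in> I" using mult_closed[OF f] by simp
    next
      fix f g assume "f \<in> I" "g \<in> I"
      then show "f \<oplus>\<^bsub>?R\<^esub> g \<in> I" using add by (simp add: pointwise_ring_def)
    qed
  next
    fix f g assume "f \<in> I" "g \<in> carrier ?R"
    then show "f \<otimes>\<^bsub>?R\<^esub> g \<in> I" by (rule mult_closed)
    moreover have "f \<in> carrier ?R" using \<open>f \<in> I\<close> sub by (auto simp: pointwise_ring_def)
    ultimately show "g \<otimes>\<^bsub>?R\<^esub> f \<in> I" using m_comm \<open>g \<in> carrier ?R\<close> by simp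
  qed
qed

lemma (in ideal) coset_eq_iff:
  assumes "x \<in> carrier R" "y \<in> carrier R"
  shows "I +> x = I +> y \<longleftrightarrow> (\<exists>i\<in>I. x = i \<oplus> y)"
proof
  assume "I +> x = I +> y"
  then have "x \<in> I +> y" using a_rcos_self assms(1) by blast
  then show "\<exists>i\<in>I. x = i \<oplus> y" by (auto simp: a_r_coset_def')
next
  assume "\<exists>i\<in>I. x = i \<oplus> y"
  then have "x \<in> I +> y" by (auto simp: a_r_coset_def')
  then show "I +> x = I +> y" using a_repr_independence assms(2) a_subgroup by metis
qed

lemma (in ideal) coset_in_Units_Quot_iff:
  assumes "cring R" "a \<in> carrier R"
  shows "I +> a \<in> Units (R Quot I) \<longleftrightarrow> (\<exists>b\<in>carrier R. \<exists>i\<in>I. a \<otimes> b = i \<oplus> \<one>)"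
proof -
  interpret cring R by (rule assms(1))
  have carr: "carrier (R Quot I) = (+>) I ` carrier R"
    by (auto simp: FactRing_def A_RCOSETS_def')
  have mult: "(I +> x) \<otimes>\<^bsub>R Quot I\<^esub> (I +> y) = I +> (x \<otimes> y)" if "x \<in> carrier R" "y \<in> carrier R" for x y
    using that by (simp add: FactRing_def rcoset_mult_add)
  have one: "\<one>\<^bsub>R Quot I\<^esub> = I +> \<one>" by (simp add: FactRing_def)
  have "I +> a \<in> Units (R Quot I) \<longleftrightarrow> (\<exists>b\<in>carrier R. I +> (a \<otimes> b) = I +> \<one>)"
    using assms(2) by (auto simp: Units_def carr mult one m_comm)
  also have "\<dots> \<longleftrightarrow> (\<exists>b\<in>carrier R. \<exists>i\<in>I. a \<otimes> b = i \<oplus> \<one>)"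
    using assms(2) by (simp add: coset_eq_iff)
  finally show ?thesis .
qed

lemma E_M_restrict:
  assumes "open \<Omega>" "growth_family \<Omega> moderate_on F"
  shows "(\<lambda>p\<in>U_set \<Omega>. F (fst p) (snd p)) \<in> E_M \<Omega>"
proof -
  have "eq_on_slices \<Omega> F (curry (\<lambda>p\<in>U_set \<Omega>. F (fst p) (snd p)))"
    by (simp add: eq_on_slices_def slice_def)
  then show ?thesis
    using growth_family_cong[OF assms(1) _ _ assms(2)] by (simp add: E_M_iff[OF assms(1)])
qed

lemma N_e_restrict:
  assumes "open \<Omega>" "growth_family \<Omega> negligible_on F"
  shows "(\<lambda>p\<in>U_set \<Omega>. F (fst p) (snd p)) \<in> N_e \<Omega>"
proof -
  have "eq_on_slices \<Omega> F (curry (\<lambda>p\<in>U_set \<Omega>. F (fst p) (snd p)))"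
    by (simp add: eq_on_slices_def slice_def)
  then show ?thesis
    using growth_family_cong[OF assms(1) _ _ assms(2)] by (simp add: N_e_iff[OF assms(1)])
qed

lemma E_M_const: "open \<Omega> \<Longrightarrow> (\<lambda>p\<in>U_set \<Omega>. c) \<in> E_M \<Omega>"
  using E_M_restrict[of \<Omega> "\<lambda>\<psi> x. c"] growth_family_const[of \<Omega> moderate_on "\<lambda>\<psi>. c"]
  by (simp add: moderate_const)

lemma E_M_add:
  assumes "open \<Omega>" "R \<in> E_M \<Omega>" "S \<in> E_M \<Omega>"
  shows "(\<lambda>p\<in>U_set \<Omega>. R p + S p) \<in> E_M \<Omega>"
  using E_M_restrict[OF assms(1) growth_family_add[OF assms(1), of moderate_on "curry R" "curry S"]]
    assms(2,3) by (simp add: E_M_iff[OF assms(1)])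

lemma E_M_mult:
  assumes "open \<Omega>" "R \<in> E_M \<Omega>" "S \<in> E_M \<Omega>"
  shows "(\<lambda>p\<in>U_set \<Omega>. R p * S p) \<in> E_M \<Omega>"
  using E_M_restrict[OF assms(1) growth_family_mult[OF assms(1), of moderate_on "curry R" "curry S"]]
    assms(2,3) by (simp add: E_M_iff[OF assms(1)])

lemma N_e_add:
  assumes "open \<Omega>" "R \<in> N_e \<Omega>" "S \<in> N_e \<Omega>"
  shows "(\<lambda>p\<in>U_set \<Omega>. R p + S p) \<in> N_e \<Omega>"
  using N_e_restrict[OF assms(1) growth_family_add[OF assms(1), of negligible_on "curry R" "curry S"]]
    assms(2,3) by (simp add: N_e_iff[OF assms(1)])

lemma N_e_mult:
  assumes "open \<Omega>" "R \<in> N_e \<Omega>" "S \<in> E_M \<Omega>"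
  shows "(\<lambda>p\<in>U_set \<Omega>. R p * S p) \<in> N_e \<Omega>"
  using N_e_restrict[OF assms(1) growth_family_mult[OF assms(1), of negligible_on "curry R" "curry S"]]
    assms(2,3) by (simp add: N_e_iff[OF assms(1)] E_M_iff[OF assms(1)])

lemma N_e_zero: "open \<Omega> \<Longrightarrow> (\<lambda>p\<in>U_set \<Omega>. 0) \<in> N_e \<Omega>"
  using N_e_restrict[of \<Omega> "\<lambda>\<psi> x. 0"] growth_family_const[of \<Omega> negligible_on "\<lambda>\<psi>. 0"]
  by (simp add: negligible_zero)

lemma N_e_subset_E_M: "open \<Omega> \<Longrightarrow> N_e \<Omega> \<subseteq> E_M \<Omega>"
  by (auto simp: N_e_iff E_M_iff negligible_family_imp_moderate_family)

lemma cring_E_M: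
  assumes "open \<Omega>"
  shows "cring (pointwise_ring (U_set \<Omega>) (E_M \<Omega>))"
proof (rule pointwise_ring_cring)
  show "(\<lambda>p\<in>U_set \<Omega>. - R p) \<in> E_M \<Omega>" if "R \<in> E_M \<Omega>" for R
  proof -
    have "(\<lambda>p\<in>U_set \<Omega>. - R p) = (\<lambda>p\<in>U_set \<Omega>. (\<lambda>p\<in>U_set \<Omega>. - 1) p * R p)" by auto
    then show ?thesis using E_M_mult[OF assms E_M_const[OF assms] that, of "-1"] by simp
  qed
  show "E_M \<Omega> \<subseteq> extensional (U_set \<Omega>)" by (auto simp: E_M_iff[OF assms])
qed (use assms in \<open>simp_all add: E_M_const E_M_add E_M_mult\<close>)

lemma ideal_N_e: "open \<Omega> \<Longrightarrow> ideal (N_e \<Omega>) (pointwise_ring (U_set \<Omega>) (E_M \<Omega>))"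
  by (rule pointwise_ring_ideal)
    (simp_all add: cring_E_M N_e_subset_E_M N_e_zero E_M_const N_e_add N_e_mult)

lemma eventually_restrict_scale_eq:
  "\<phi> \<in> \<A> 0 \<Longrightarrow> \<forall>\<^sub>F \<epsilon> in at_right 0. restrict r (\<A> 0) (scale \<epsilon> \<phi>) = r (scale \<epsilon> \<phi>)"
  using eventually_scale_moment_functions by (rule eventually_mono) auto

lemma C_M_restrict:
  assumes "moderate_on {()} (\<lambda>\<psi> _. r \<psi>)"
  shows "restrict r (\<A> 0) \<in> C_M"
proof -
  have "moderate_on {()} (\<lambda>\<psi> _. restrict r (\<A> 0) \<psi>)"
    by (rule moderate_transfer[OF assms, of 0])
      (auto intro!: eventually_mono[OF eventually_restrict_scale_eq[of _ r]])
  then show ?thesis by (simp add: C_M_iff)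
qed

lemma C_N_restrict:
  assumes "negligible_on {()} (\<lambda>\<psi> _. r \<psi>)"
  shows "restrict r (\<A> 0) \<in> C_N"
proof -
  have "negligible_on {()} (\<lambda>\<psi> _. restrict r (\<A> 0) \<psi>)"
    by (rule negligible_transfer[OF assms, of 0])
      (auto intro!: eventually_mono[OF eventually_restrict_scale_eq[of _ r]])
  then show ?thesis by (simp add: C_N_iff)
qed

lemma cring_C_M: "cring (C_M_ring :: 'n::finite gnum ring)"
  unfolding C_M_ring_def
proof (rule pointwise_ring_cring)
  fix r s :: "'n gnum" assume "r \<in> C_M"
  then have r: "moderate_on {()} (\<lambda>\<psi> _. r \<psi>)" by (simp add: C_M_iff)
  show "(\<lambda>\<psi>\<in>\<A> 0. - r \<psi>) \<in> C_M"
    using moderate_mult[OF moderate_const[of "{()}" "-1"] r] by (intro C_M_restrict) simp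
  assume "s \<in> C_M"
  then have s: "moderate_on {()} (\<lambda>\<psi> _. s \<psi>)" by (simp add: C_M_iff)
  show "(\<lambda>\<psi>\<in>\<A> 0. r \<psi> + s \<psi>) \<in> C_M" using moderate_add[OF r s] by (intro C_M_restrict) simp
  show "(\<lambda>\<psi>\<in>\<A> 0. r \<psi> * s \<psi>) \<in> C_M" using moderate_mult[OF r s] by (intro C_M_restrict) simp
qed (auto simp: C_M_iff[THEN iffD1] moderate_const intro!: C_M_restrict)

lemma ideal_C_N: "ideal C_N (C_M_ring :: 'n::finite gnum ring)"
  unfolding C_M_ring_def
proof (rule pointwise_ring_ideal)
  show "C_N \<subseteq> (C_M :: 'n gnum set)" by (auto simp: C_N_iff C_M_iff negligible_imp_moderate)
next
  fix r s :: "'n gnum" assume "r \<in> C_N"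
  then have r: "negligible_on {()} (\<lambda>\<psi> _. r \<psi>)" by (simp add: C_N_iff)
  show "(\<lambda>\<psi>\<in>\<A> 0. r \<psi> + s \<psi>) \<in> C_N" if "s \<in> C_N"
    using negligible_add[OF r, of "\<lambda>\<psi> _. s \<psi>"] that by (intro C_N_restrict) (simp add: C_N_iff)
  show "(\<lambda>\<psi>\<in>\<A> 0. r \<psi> * s \<psi>) \<in> C_N" if "s \<in> C_M"
    using negligible_mult[OF r, of "\<lambda>\<psi> _. s \<psi>"] that by (intro C_N_restrict) (simp add: C_M_iff)
qed (auto simp: cring_C_M[unfolded C_M_ring_def] moderate_const negligible_zero
    intro!: C_M_restrict C_N_restrict)

section \<open>Point values\<close>

lemma point_equiv_iff:
  "(X, Y) \<in> point_equiv \<Omega> \<longleftrightarrow>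
    X \<in> Omega_M \<Omega> \<and> Y \<in> Omega_M \<Omega> \<and> negligible_on {()} (\<lambda>\<psi> _. X \<psi> - Y \<psi>)"
  using negligible_iff_bigo[of "\<lambda>\<phi> \<epsilon>. norm (X (scale \<epsilon> \<phi>) - Y (scale \<epsilon> \<phi>))" "{()}" "\<lambda>\<psi> _. X \<psi> - Y \<psi>"]
    norm_bigo_iff_order_bound[of "\<lambda>\<psi>. X \<psi> - Y \<psi>"]
  by (simp add: point_equiv_def)

lemma negligible_norm:
  assumes "negligible_on B F" "\<And>\<psi> b. norm (G \<psi> b) = norm (F \<psi> b)"
  shows "negligible_on B G"
  by (rule negligible_transfer[OF assms(1), of 0]) (auto intro!: always_eventually simp: assms(2))

lemma gen_points_negligible_diff:
  assumes "\<xi> \<in> gen_points \<Omega>" "X \<in> \<xi>" "Y \<in> \<xi>"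
  shows "negligible_on {()} (\<lambda>\<psi> _. X \<psi> - Y \<psi>)"
proof -
  obtain Z where Z: "(Z, X) \<in> point_equiv \<Omega>" "(Z, Y) \<in> point_equiv \<Omega>"
    using assms unfolding gen_points_def quotient_def by auto
  have "negligible_on {()} (\<lambda>\<psi> _. X \<psi> - Z \<psi>)"
    by (rule negligible_norm[of _ "\<lambda>\<psi> _. Z \<psi> - X \<psi>"]) (use Z point_equiv_iff norm_minus_commute in auto)
  moreover have "negligible_on {()} (\<lambda>\<psi> _. Z \<psi> - Y \<psi>)" using Z by (simp add: point_equiv_iff)
  ultimately show ?thesis using negligible_add[of "{()}" "\<lambda>\<psi> _. X \<psi> - Z \<psi>" "\<lambda>\<psi> _. Z \<psi> - Y \<psi>"] by simp
qed

lemma gen_points_subset: "\<xi> \<in> gen_points \<Omega> \<Longrightarrow> \<xi> \<subseteq> Omega_M \<Omega>"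
  unfolding gen_points_def quotient_def by (auto simp: point_equiv_iff)

lemma point_class:
  assumes "X \<in> Omega_M \<Omega>"
  shows "point_equiv \<Omega> `` {X} \<in> gen_points \<Omega>" "X \<in> point_equiv \<Omega> `` {X}"
  using assms by (auto simp: gen_points_def quotientI point_equiv_iff negligible_zero)

lemma eventually_in_U_set:
  assumes "X \<in> Omega_M \<Omega>" "\<phi> \<in> \<A> 0"
  shows "\<forall>\<^sub>F \<epsilon> in at_right 0. scale \<epsilon> \<phi> \<in> \<A> 0 \<and> (scale \<epsilon> \<phi>, X (scale \<epsilon> \<phi>)) \<in> U_set \<Omega>"
  using assms eventually_scale_moment_functions[OF assms(2)] unfolding Omega_M_def
  by (auto intro: eventually_conj)

text \<open>For small \<open>\<epsilon>\<close> the value at a compactly supported point is one of the values on a fixed compact set,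
  or the default value 0. Hence bounds on that compact set carry over to the point value.\<close>

lemma eval_at_dominated:
  assumes "\<forall>\<phi>\<in>\<A> N. \<forall>\<^sub>F \<epsilon> in at_right 0. X (scale \<epsilon> \<phi>) \<in> K"
  shows "\<forall>\<phi>\<in>\<A> N. \<forall>\<^sub>F \<epsilon> in at_right 0. \<forall>b\<in>{()}. \<exists>x\<in>K.
    norm (eval_at \<Omega> R X (scale \<epsilon> \<phi>)) \<le> norm (curry R (scale \<epsilon> \<phi>) x)"
proof
  fix \<phi> :: "real^'a \<Rightarrow> complex" assume \<phi>: "\<phi> \<in> \<A> N"
  show "\<forall>\<^sub>F \<epsilon> in at_right 0. \<forall>b\<in>{()}. \<exists>x\<in>K.
    norm (eval_at \<Omega> R X (scale \<epsilon> \<phi>)) \<le> norm (curry R (scale \<epsilon> \<phi>) x)"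
    using eventually_scale_moment_functions[OF moment_functions_le_0[OF \<phi>]] assms[rule_format, OF \<phi>]
    by eventually_elim (auto simp: eval_at_def)
qed

lemma eval_at_extensional: "eval_at \<Omega> R X \<in> extensional (\<A> 0)"
  by (simp add: eval_at_def)

lemma eval_at_C_M:
  assumes "open \<Omega>" "R \<in> E_M \<Omega>" "compactly_supported \<Omega> X"
  shows "eval_at \<Omega> R X \<in> C_M"
proof -
  obtain K N where K: "compact K" "K \<subseteq> \<Omega>"
    and X: "\<forall>\<phi>\<in>\<A> N. \<forall>\<^sub>F \<epsilon> in at_right 0. X (scale \<epsilon> \<phi>) \<in> K"
    using assms(3) unfolding compactly_supported_def by blast
  have "moderate_on K (curry R)" 
    using assms(2) growth_familyD[of \<Omega> moderate_on "curry R", OF _ K] by (simp add: E_M_iff[OF assms(1)])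
  from moderate_transfer[OF this eval_at_dominated[OF X]] show ?thesis
    by (simp add: C_M_iff eval_at_extensional)
qed

lemma eval_at_C_N:
  assumes "open \<Omega>" "R \<in> N_e \<Omega>" "compactly_supported \<Omega> X"
  shows "eval_at \<Omega> R X \<in> C_N"
proof -
  obtain K N where K: "compact K" "K \<subseteq> \<Omega>"
    and X: "\<forall>\<phi>\<in>\<A> N. \<forall>\<^sub>F \<epsilon> in at_right 0. X (scale \<epsilon> \<phi>) \<in> K"
    using assms(3) unfolding compactly_supported_def by blast
  have "negligible_on K (curry R)" 
    using assms(2) growth_familyD[of \<Omega> negligible_on "curry R", OF _ K] by (simp add: N_e_iff[OF assms(1)])
  from negligible_transfer[OF this eval_at_dominated[OF X]] show ?thesis
    by (simp add: C_N_iff eval_at_extensional)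
qed

lemma norm_derivative_le_sum_partial_deriv:
  fixes f :: "real^'n::finite \<Rightarrow> complex"
  assumes "(f has_derivative f') (at x)"
  shows "norm (f' v) \<le> norm v * (\<Sum>i\<in>UNIV. norm (partial_deriv i f x))"
proof -
  have lin: "linear f'" using assms by (rule has_derivative_linear)
  have "f' v = f' (\<Sum>i\<in>UNIV. v $ i *\<^sub>R axis i 1)"
    using basis_expansion[of v] by (simp add: scalar_mult_eq_scaleR)
  also have "\<dots> = (\<Sum>i\<in>UNIV. v $ i *\<^sub>R partial_deriv i f x)"
    by (simp add: linear_sum[OF lin] linear_cmul[OF lin] partial_deriv_eq[OF assms])
  also have "norm \<dots> \<le> (\<Sum>i\<in>UNIV. norm (v $ i *\<^sub>R partial_deriv i f x))" by (rule norm_sum)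
  also have "\<dots> \<le> (\<Sum>i\<in>UNIV. norm v * norm (partial_deriv i f x))"
    by (intro sum_mono) (simp add: mult_right_mono component_le_norm_cart)
  finally show ?thesis by (simp add: sum_distrib_left)
qed

text \<open>The bound is attained at an intermediate point rather than by a supremum over the segment. In this
  form a bound on the gradient over a compact set can be inserted by \<open>negligible_transfer\<close>.\<close>

lemma mean_value_partial_deriv:
  fixes f :: "real^'n::finite \<Rightarrow> complex"
  assumes "\<And>z. z \<in> closed_segment x y \<Longrightarrow> f differentiable at z"
  shows "\<exists>z\<in>closed_segment x y. norm (f x - f y) \<le> norm (x - y) * (\<Sum>i\<in>UNIV. norm (partial_deriv i f z))"
proof -
  define \<gamma> where "\<gamma> t = y + t *\<^sub>R (x - y)" for t
  have seg: "\<gamma> t \<in> closed_segment x y" if "0 \<le> t" "t \<le> 1" for t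
  proof -
    have "\<gamma> t = (1 - t) *\<^sub>R y + t *\<^sub>R x" by (simp add: \<gamma>_def algebra_simps)
    then have "\<gamma> t \<in> closed_segment y x" using that by (auto simp: in_segment)
    then show ?thesis by (simp add: closed_segment_commute)
  qed
  have der: "((\<lambda>t. f (\<gamma> t)) has_derivative (\<lambda>h. frechet_derivative f (at (\<gamma> t)) (h *\<^sub>R (x - y)))) (at t)"
    if "0 \<le> t" "t \<le> 1" for t
  proof (rule has_derivative_compose[of \<gamma>])
    show "(\<gamma> has_derivative (\<lambda>h. h *\<^sub>R (x - y))) (at t)"
      unfolding \<gamma>_def by (auto intro!: derivative_eq_intros)
    show "(f has_derivative frechet_derivative f (at (\<gamma> t))) (at (\<gamma> t))"
      using assms[OF seg[OF that]] by (simp add: frechet_derivative_works)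
  qed
  have "\<exists>t\<in>{0<..<1}. norm (f (\<gamma> 1) - f (\<gamma> 0)) \<le>
      norm (frechet_derivative f (at (\<gamma> t)) ((1 - 0) *\<^sub>R (x - y)))"
  proof (rule mvt_general)
    show "continuous_on {0..1} (\<lambda>t. f (\<gamma> t))"
      using has_derivative_continuous[OF der] by (intro continuous_at_imp_continuous_on) auto
    show "((\<lambda>t. f (\<gamma> t)) has_derivative (\<lambda>h. frechet_derivative f (at (\<gamma> t)) (h *\<^sub>R (x - y)))) (at t)"
      if "0 < t" "t < 1" for t using der that by simp
  qed simp
  then obtain t where t: "0 < t" "t < 1"
    and le: "norm (f (\<gamma> 1) - f (\<gamma> 0)) \<le> norm (frechet_derivative f (at (\<gamma> t)) (x - y))"
    by auto
  have "\<gamma> t \<in> closed_segment x y" using t by (intro seg) auto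
  moreover have "norm (f x - f y) \<le> norm (x - y) * (\<Sum>i\<in>UNIV. norm (partial_deriv i f (\<gamma> t)))"
  proof -
    have "(f has_derivative frechet_derivative f (at (\<gamma> t))) (at (\<gamma> t))"
      using assms[OF calculation] by (simp add: frechet_derivative_works)
    from norm_derivative_le_sum_partial_deriv[OF this, of "x - y"] le
    show ?thesis by (simp add: \<gamma>_def)
  qed
  ultimately show ?thesis by blast
qed

lemma eventually_norm_less_of_negligible:
  assumes "negligible_on {()} (\<lambda>\<psi> _. X \<psi>)" "\<delta> > 0"
  shows "\<exists>q. \<forall>\<phi>\<in>\<A> q. \<forall>\<^sub>F \<epsilon> in at_right 0. norm (X (scale \<epsilon> \<phi>)) < \<delta>"
proof -
  have "growth {()} 1 (\<lambda>\<psi> _. X \<psi>)" using assms(1) unfolding negligible_on_def by blast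
  then obtain q where q: "\<forall>\<phi>\<in>\<A> q. order_bound {()} 1 (\<lambda>\<psi> _. X \<psi>) \<phi>" unfolding growth_def by blast
  have "\<forall>\<^sub>F \<epsilon> in at_right 0. norm (X (scale \<epsilon> \<phi>)) < \<delta>" if \<phi>: "\<phi> \<in> \<A> q" for \<phi>
  proof -
    obtain C where C: "C > 0"
      and ev: "\<forall>\<^sub>F \<epsilon> in at_right 0. 0 < \<epsilon> \<and> (\<forall>b\<in>{()}. norm (X (scale \<epsilon> \<phi>)) \<le> C * \<epsilon> powi 1)"
      using order_boundE q \<phi> by blast
    have "\<forall>\<^sub>F \<epsilon> in at_right 0. \<epsilon> \<in> {0<..<\<delta> / C}"
      using C assms(2) by (intro eventually_at_right_real) simp
    with ev show ?thesis
    proof eventually_elim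
      case (elim \<epsilon>)
      then have "norm (X (scale \<epsilon> \<phi>)) \<le> C * \<epsilon>" by simp
      also have "\<dots> < \<delta>" using elim C by (simp add: field_simps)
      finally show ?case .
    qed
  qed
  then show ?thesis by blast
qed

lemma moderate_sum:
  assumes "finite I" "\<And>i. i \<in> I \<Longrightarrow> moderate_on B (F i)"
  shows "moderate_on B (\<lambda>\<psi> b. \<Sum>i\<in>I. F i \<psi> b)"
  using assms
proof (induction I)
  case empty
  then show ?case by (simp add: moderate_const)
next
  case (insert i I)
  then have "moderate_on B (\<lambda>\<psi> b. F i \<psi> b + (\<Sum>i\<in>I. F i \<psi> b))" by (intro moderate_add) auto
  then show ?case using insert by simp
qed

text \<open>The value of a generalized function depends only on the class of the point: by the mean value
  theorem the difference of the two values is at most the negligible distance of the two points times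
  the gradient of \<open>R\<close>. The segment between the points may leave the compact set \<open>K\<close> that contains the
  first of them, so the gradient is bounded on the closed \<open>\<delta>\<close>-neighbourhood \<open>L\<close> of \<open>K\<close>, with \<open>\<delta>\<close> so
  small that \<open>L\<close> is still inside \<open>\<Omega>\<close>.\<close>

lemma eval_at_point_diff_negligible:
  fixes \<Omega> :: "(real^'n::finite) set"
  assumes "open \<Omega>" "R \<in> E_M \<Omega>" and XY: "X \<in> Omega_M \<Omega>" "Y \<in> Omega_M \<Omega>"
    and "compactly_supported \<Omega> X" and diff: "negligible_on {()} (\<lambda>\<psi> _. X \<psi> - Y \<psi>)"
  shows "negligible_on {()} (\<lambda>\<psi> _. eval_at \<Omega> R X \<psi> - eval_at \<Omega> R Y \<psi>)"
proof -
  obtain K N where K: "compact K" "K \<subseteq> \<Omega>"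
    and N: "\<forall>\<phi>\<in>\<A> N. \<forall>\<^sub>F \<epsilon> in at_right 0. X (scale \<epsilon> \<phi>) \<in> K"
    using assms(5) unfolding compactly_supported_def by blast
  obtain \<delta> where \<delta>: "\<delta> > 0" "(\<Union>x\<in>K. cball x \<delta>) \<subseteq> \<Omega>"
    using compact_subset_open_imp_cball_epsilon_subset K assms(1) by metis
  \<comment> \<open>The union of the balls \<open>cball x \<delta>\<close> with \<open>x \<in> K\<close>, written as a sum of compact sets.\<close>
  define L where "L = (\<Union>x\<in>K. \<Union>y\<in>cball 0 \<delta>. {x + y})"
  have "compact L" unfolding L_def by (intro compact_sums' K(1)) simp
  have cball_L: "cball x \<delta> \<subseteq> L" if "x \<in> K" for x
  proof
    fix z assume "z \<in> cball x \<delta>"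
    then have "z - x \<in> cball 0 \<delta>" "z = x + (z - x)" by (simp_all add: dist_norm norm_minus_commute)
    then show "z \<in> L" unfolding L_def using that by blast
  qed
  have "L \<subseteq> \<Omega>"
  proof
    fix z assume "z \<in> L"
    then obtain x y where "x \<in> K" "norm y \<le> \<delta>" "z = x + y" unfolding L_def by auto
    then have "z \<in> cball x \<delta>" by (simp add: dist_norm)
    then show "z \<in> \<Omega>" using \<delta>(2) \<open>x \<in> K\<close> by blast
  qed
  have gf: "growth_family \<Omega> moderate_on (curry R)" using assms(2) by (simp add: E_M_iff[OF assms(1)])
  define G where "G \<psi> x = (\<Sum>i\<in>UNIV. norm (partial_deriv i (curry R \<psi>) x))" for \<psi> x
  have "moderate_on L (\<lambda>\<psi> x. norm (partial_deriv i (curry R \<psi>) x))" for i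
    by (rule moderate_transfer[OF growth_family_partial_derivD[OF gf \<open>compact L\<close> \<open>L \<subseteq> \<Omega>\<close>], of 0])
      (auto intro!: always_eventually)
  then have "moderate_on L G" unfolding G_def by (intro moderate_sum) auto
  moreover have "negligible_on L (\<lambda>\<psi> x. norm (X \<psi> - Y \<psi>))"
    by (rule negligible_transfer[OF diff, of 0]) (auto intro!: always_eventually)
  ultimately have neg: "negligible_on L (\<lambda>\<psi> x. norm (X \<psi> - Y \<psi>) * G \<psi> x)"
    by (rule negligible_mult[rotated])
  obtain q where q: "\<forall>\<phi>\<in>\<A> q. \<forall>\<^sub>F \<epsilon> in at_right 0. norm (X (scale \<epsilon> \<phi>) - Y (scale \<epsilon> \<phi>)) < \<delta>"
    using eventually_norm_less_of_negligible[OF diff \<delta>(1)] by blast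
  show ?thesis
  proof (rule negligible_transfer[OF neg, of "max N q"], rule ballI)
    fix \<phi> :: "real^'n \<Rightarrow> complex" assume "\<phi> \<in> \<A> (max N q)"
    then have \<phi>: "\<phi> \<in> \<A> N" "\<phi> \<in> \<A> q" "\<phi> \<in> \<A> 0"
      using moment_functions_le_0 by (auto simp: moment_functions_max)
    show "\<forall>\<^sub>F \<epsilon> in at_right 0. \<forall>b\<in>{()}. \<exists>x\<in>L.
      norm (eval_at \<Omega> R X (scale \<epsilon> \<phi>) - eval_at \<Omega> R Y (scale \<epsilon> \<phi>))
        \<le> norm (norm (X (scale \<epsilon> \<phi>) - Y (scale \<epsilon> \<phi>)) * G (scale \<epsilon> \<phi>) x)"
      using N[rule_format, OF \<phi>(1)] q[rule_format, OF \<phi>(2)]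
        eventually_in_U_set[OF XY(1) \<phi>(3)] eventually_in_U_set[OF XY(2) \<phi>(3)]
        eventually_subset_slice[OF assms(1) \<open>compact L\<close> \<open>L \<subseteq> \<Omega>\<close> \<phi>(3)]
    proof eventually_elim
      case (elim \<epsilon>)
      let ?\<psi> = "scale \<epsilon> \<phi>"
      have "Y ?\<psi> \<in> cball (X ?\<psi>) \<delta>" using elim(2) by (simp add: dist_norm)
      then have seg: "closed_segment (X ?\<psi>) (Y ?\<psi>) \<subseteq> L"
        using cball_L[OF elim(1)] \<delta>(1) closed_segment_subset[of "X ?\<psi>" "cball (X ?\<psi>) \<delta>" "Y ?\<psi>"]
        by (auto simp: convex_cball)
      have "smooth_family \<Omega> (curry R)" using gf by (simp add: growth_family_def)
      then have "curry R ?\<psi> differentiable at z" if "z \<in> closed_segment (X ?\<psi>) (Y ?\<psi>)" for z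
        using smooth_family_differentiable[OF assms(1)] elim(3,5) seg that by blast
      from mean_value_partial_deriv[OF this]
      obtain z where "z \<in> closed_segment (X ?\<psi>) (Y ?\<psi>)"
        and z: "norm (curry R ?\<psi> (X ?\<psi>) - curry R ?\<psi> (Y ?\<psi>)) \<le> norm (X ?\<psi> - Y ?\<psi>) * G ?\<psi> z"
        unfolding G_def by blast
      then have "z \<in> L" using seg by blast
      moreover have "norm (eval_at \<Omega> R X ?\<psi> - eval_at \<Omega> R Y ?\<psi>) \<le> norm (norm (X ?\<psi> - Y ?\<psi>) * G ?\<psi> z)"
        using z elim(3,4) by (simp add: eval_at_def abs_mult G_def sum_nonneg)
      ultimately show ?case by blast
    qed
  qed
qed

lemma point_value_eq:
  fixes \<Omega> :: "(real^'n::finite) set"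
  assumes "open \<Omega>" "R \<in> E_M \<Omega>" "\<xi> \<in> gen_points \<Omega>" "X \<in> \<xi>" "compactly_supported \<Omega> X"
  shows "point_value \<Omega> (N_e \<Omega> +>\<^bsub>pointwise_ring (U_set \<Omega>) (E_M \<Omega>)\<^esub> R) \<xi>
    = C_N +>\<^bsub>C_M_ring\<^esub> eval_at \<Omega> R X"
proof -
  let ?E = "pointwise_ring (U_set \<Omega>) (E_M \<Omega>)"
  interpret E: ideal "N_e \<Omega>" ?E by (rule ideal_N_e[OF assms(1)])
  interpret C: ideal "C_N :: 'n gnum set" C_M_ring by (rule ideal_C_N)
  have unique: "C_N +>\<^bsub>C_M_ring\<^esub> eval_at \<Omega> R' X' = C_N +>\<^bsub>C_M_ring\<^esub> eval_at \<Omega> R X"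
    if R': "R' \<in> N_e \<Omega> +>\<^bsub>?E\<^esub> R" and X': "X' \<in> \<xi>" "compactly_supported \<Omega> X'" for R' X'
  proof -
    obtain J where J: "J \<in> N_e \<Omega>" and R'_eq: "R' = (\<lambda>p\<in>U_set \<Omega>. J p + R p)"
      using R' by (auto simp: a_r_coset_def' pointwise_ring_def)
    have JM: "J \<in> E_M \<Omega>" using J N_e_subset_E_M[OF assms(1)] by blast
    have "R' \<in> E_M \<Omega>" unfolding R'_eq by (rule E_M_add[OF assms(1) JM assms(2)])
    have om: "X \<in> Omega_M \<Omega>" "X' \<in> Omega_M \<Omega>" using gen_points_subset assms(3,4) X'(1) by blast+
    define j where "j = (\<lambda>\<psi>\<in>\<A> 0. eval_at \<Omega> J X' \<psi> + (eval_at \<Omega> R X' \<psi> - eval_at \<Omega> R X \<psi>))"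
    have "j \<in> C_N" unfolding j_def
    proof (intro C_N_restrict negligible_add)
      show "negligible_on {()} (\<lambda>\<psi> _. eval_at \<Omega> J X' \<psi>)"
        using eval_at_C_N[OF assms(1) J X'(2)] by (simp add: C_N_iff)
      show "negligible_on {()} (\<lambda>\<psi> _. eval_at \<Omega> R X' \<psi> - eval_at \<Omega> R X \<psi>)"
        using gen_points_negligible_diff[OF assms(3) X'(1) assms(4)]
        by (rule eval_at_point_diff_negligible[OF assms(1,2) om(2,1) X'(2)])
    qed
    moreover have "eval_at \<Omega> R' X' = j \<oplus>\<^bsub>C_M_ring\<^esub> eval_at \<Omega> R X"
      by (auto simp: C_M_ring_def pointwise_ring_def j_def R'_eq eval_at_def fun_eq_iff)
    moreover have "eval_at \<Omega> R' X' \<in> carrier C_M_ring" "eval_at \<Omega> R X \<in> carrier C_M_ring"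
      using eval_at_C_M[OF assms(1) \<open>R' \<in> E_M \<Omega>\<close> X'(2)] eval_at_C_M[OF assms(1,2,5)]
      by (simp_all add: C_M_ring_def pointwise_ring_def)
    ultimately show ?thesis using C.coset_eq_iff by blast
  qed
  have "R \<in> N_e \<Omega> +>\<^bsub>?E\<^esub> R" using E.a_rcos_self assms(2) by (simp add: pointwise_ring_def)
  then show ?thesis
    unfolding point_value_def using assms(4,5) unique by (intro the_equality) blast+
qed

section \<open>Invertibility\<close>

lemma bdd_above_norm_moment_function:
  assumes "\<psi> \<in> \<A> 0"
  shows "bdd_above (range (\<lambda>x. cmod (\<psi> x)))"
proof -
  have "continuous_on (supp \<psi>) \<psi>" "compact (supp \<psi>)"
    using assms smooth_on_imp_continuous_on continuous_on_subset[of UNIV]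
    unfolding moment_functions_def test_functions_def by blast+
  then have "bounded (\<psi> ` supp \<psi>)" by (intro compact_imp_bounded compact_continuous_image)
  then obtain M where M: "M > 0" "\<And>x. x \<in> supp \<psi> \<Longrightarrow> cmod (\<psi> x) \<le> M" by (auto simp: bounded_pos)
  have "cmod (\<psi> x) \<le> M" for x
  proof (cases "x \<in> supp \<psi>")
    case False
    then have "\<psi> x = 0" using closure_subset[of "{x. \<psi> x \<noteq> 0}"] by (auto simp: supp_def)
    then show ?thesis using M(1) by simp
  qed (rule M(2))
  then show ?thesis by (intro bdd_aboveI2)
qed

lemma exp_minus_le_power:
  fixes y :: real
  assumes "y > 0" "m > 0"
  shows "exp (- y) \<le> (real m / y) ^ m"
proof -
  \<comment> \<open>Raise \<open>t \<le> exp t\<close> at \<open>t = y / m\<close> to the power \<open>m\<close>.\<close>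
  have "y / real m \<le> exp (y / real m)" using exp_ge_add_one_self[of "y / real m"] by linarith
  then have "(y / real m) ^ m \<le> exp (y / real m) ^ m" using assms by (intro power_mono) auto
  also have "\<dots> = exp y" using assms(2) by (simp flip: exp_of_nat_mult)
  finally have "inverse (exp y) \<le> inverse ((y / real m) ^ m)" using assms by (intro le_imp_inverse_le) auto
  then show ?thesis by (simp add: exp_minus power_inverse[symmetric])
qed

text \<open>A strictly positive weight with \<open>flat (scale \<epsilon> \<phi>) = exp (- M / \<epsilon>\<^sup>n)\<close>, for \<open>\<phi> \<in> \<A> 0\<close>, where
  \<open>M > 0\<close> is the maximum of the modulus of \<open>\<phi>\<close>: positive everywhere, and yet smaller than every power of \<open>\<epsilon>\<close>.\<close>

definition flat :: "(real^'n::finite \<Rightarrow> complex) \<Rightarrow> real" where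
  "flat \<psi> = exp (- (SUP x. cmod (\<psi> x)))"

lemma negligible_flat: "negligible_on B (\<lambda>\<psi> b. complex_of_real (flat \<psi>))"
proof -
  have "order_bound B k (\<lambda>\<psi> b. complex_of_real (flat \<psi>)) \<phi>" if \<phi>: "\<phi> \<in> \<A> 0"
    for k and \<phi> :: "real^'n::finite \<Rightarrow> complex"
  proof (rule order_bound_mono)
    define m where "m = max 1 (nat k)"
    \<comment> \<open>One nonzero value \<open>c\<close> of the modulus suffices, as it bounds the maximum from below.\<close>
    have "\<phi> \<noteq> (\<lambda>x. 0)" using \<phi> by (auto simp: moment_functions_def)
    then obtain z where z: "\<phi> z \<noteq> 0" by blast
    define c where "c = cmod (\<phi> z)"
    have c: "c > 0" using z by (simp add: c_def)
    have "\<forall>\<^sub>F \<epsilon> in at_right (0::real). \<epsilon> \<in> {0<..<1}" by (rule eventually_at_right_real) simp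
    with eventually_scale_moment_functions[OF \<phi>]
    have "\<forall>\<^sub>F \<epsilon> in at_right 0. flat (scale \<epsilon> \<phi>) \<le> (real m / c) ^ m * \<epsilon> powi (int m)"
    proof eventually_elim
      case (elim \<epsilon>)
      then have \<epsilon>: "0 < \<epsilon>" "\<epsilon> < 1" by auto
      have "cmod (scale \<epsilon> \<phi> (\<epsilon> *\<^sub>R z)) \<le> (SUP x. cmod (scale \<epsilon> \<phi> x))"
        by (rule cSUP_upper[OF UNIV_I bdd_above_norm_moment_function[OF elim(1)]])
      moreover have "cmod (scale \<epsilon> \<phi> (\<epsilon> *\<^sub>R z)) = c / \<epsilon> ^ CARD('n)"
        using \<epsilon> by (simp add: scale_def c_def norm_mult norm_divide norm_power)
      moreover have "c / \<epsilon> \<le> c / \<epsilon> ^ CARD('n)"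
      proof (rule divide_left_mono)
        show "\<epsilon> ^ CARD('n) \<le> \<epsilon>" using \<epsilon> power_decreasing[of 1 "CARD('n)" \<epsilon>] by simp
      qed (use \<epsilon> c in auto)
      ultimately have "flat (scale \<epsilon> \<phi>) \<le> exp (- (c / \<epsilon>))" by (simp add: flat_def)
      also have "\<dots> \<le> (real m / (c / \<epsilon>)) ^ m"
        using \<epsilon> c by (intro exp_minus_le_power) (auto simp: m_def)
      also have "\<dots> = (real m / c) ^ m * \<epsilon> powi (int m)" by (simp flip: power_mult_distrib)
      finally show ?case .
    qed
    moreover have "flat \<psi> > 0" for \<psi> :: "real^'n \<Rightarrow> complex" by (simp add: flat_def)
    ultimately show "order_bound B (int m) (\<lambda>\<psi> b. complex_of_real (flat \<psi>)) \<phi>"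
      unfolding order_bound_def by (auto intro!: exI[of _ "(real m / c) ^ m"] elim!: eventually_mono simp: less_imp_le)
    show "k \<le> int m" by (simp add: m_def)
  qed
  then show ?thesis unfolding negligible_on_def growth_def by blast
qed

text \<open>The generalized point at which \<open>R\<close> is as close to zero as it gets on \<open>K\<close>. Choosing, for every \<open>\<psi>\<close>, a
  minimizer of the modulus of \<open>R(\<psi>, \<cdot>)\<close> is a choice per test function, and so it is automatically
  consistent along all scaling orbits.\<close>

lemma argmin_point:
  fixes \<Omega> :: "(real^'n::finite) set"
  assumes "open \<Omega>" "R \<in> E_M \<Omega>" "compact K" "K \<subseteq> \<Omega>" "K \<noteq> {}"
  obtains X where "X \<in> Omega_M \<Omega>" "compactly_supported \<Omega> X"
    and "\<And>\<psi> x. \<psi> \<in> \<A> 0 \<Longrightarrow> K \<subseteq> slice \<Omega> \<psi> \<Longrightarrow> x \<in> K \<Longrightarrow>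
      X \<psi> \<in> K \<and> cmod (R (\<psi>, X \<psi>)) \<le> cmod (R (\<psi>, x))"
proof -
  have "\<exists>x. x \<in> K \<and> (K \<subseteq> slice \<Omega> \<psi> \<longrightarrow> (\<forall>y\<in>K. cmod (R (\<psi>, x)) \<le> cmod (R (\<psi>, y))))"
    if "\<psi> \<in> \<A> 0" for \<psi>
  proof (cases "K \<subseteq> slice \<Omega> \<psi>")
    case True
    have "smooth_on (slice \<Omega> \<psi>) (curry R \<psi>)"
      using assms(2) that by (simp add: E_M_iff[OF assms(1)] growth_family_def smooth_family_def)
    then have "continuous_on K (\<lambda>x. cmod (curry R \<psi> x))"
      using True smooth_on_imp_continuous_on continuous_on_subset continuous_on_norm by blast
    then obtain x where "x \<in> K" "\<forall>y\<in>K. cmod (curry R \<psi> x) \<le> cmod (curry R \<psi> y)"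
      using continuous_attains_inf[OF assms(3,5)] by blast
    then show ?thesis by auto
  qed (use assms(5) in blast)
  then obtain X0 where X0: "\<And>\<psi>. \<psi> \<in> \<A> 0 \<Longrightarrow> X0 \<psi> \<in> K"
    "\<And>\<psi> x. \<psi> \<in> \<A> 0 \<Longrightarrow> K \<subseteq> slice \<Omega> \<psi> \<Longrightarrow> x \<in> K \<Longrightarrow> cmod (R (\<psi>, X0 \<psi>)) \<le> cmod (R (\<psi>, x))"
    by metis
  define X where "X = restrict X0 (\<A> 0)"
  have XK: "X \<psi> \<in> K" if "\<psi> \<in> \<A> 0" for \<psi> using X0(1) that by (simp add: X_def)
  have evK: "\<forall>\<^sub>F \<epsilon> in at_right 0. X (scale \<epsilon> \<phi>) \<in> K" if "\<phi> \<in> \<A> 0" for \<phi>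
    using eventually_scale_moment_functions[OF that] by (rule eventually_mono) (rule XK)
  obtain M where M: "\<And>x. x \<in> K \<Longrightarrow> norm x \<le> M" using compact_imp_bounded[OF assms(3)] by (auto simp: bounded_iff)
  have "order_bound {()} 0 (\<lambda>\<psi> _. X \<psi>) \<phi>" if "\<phi> \<in> \<A> 0" for \<phi>
    unfolding order_bound_def using evK[OF that] M by (auto intro!: exI[of _ M] elim!: eventually_mono)
  then have "moderate_on {()} (\<lambda>\<psi> _. X \<psi>)" unfolding moderate_on_def growth_def by blast
  then have "\<exists>N\<ge>1. \<forall>\<phi>\<in>\<A> N. (\<lambda>\<epsilon>. norm (X (scale \<epsilon> \<phi>))) \<in> O[at_right 0](\<lambda>\<epsilon>. 1 / \<epsilon> ^ N)"
    by (subst moderate_iff_bigo[where F = "\<lambda>\<psi> _. X \<psi>" and B = "{()}"]) (simp_all add: norm_bigo_iff_order_bound)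
  moreover have "\<forall>\<^sub>F \<epsilon> in at_right 0. (scale \<epsilon> \<phi>, X (scale \<epsilon> \<phi>)) \<in> U_set \<Omega>" if "\<phi> \<in> \<A> 0" for \<phi>
    using eventually_subset_slice[OF assms(1,3,4) that] evK[OF that]
    by eventually_elim (auto simp: slice_def)
  moreover have "X \<in> \<A> 0 \<rightarrow>\<^sub>E \<Omega>" using X0(1) assms(4) by (auto simp: X_def)
  ultimately have "X \<in> Omega_M \<Omega>" by (simp add: Omega_M_def)
  moreover have "compactly_supported \<Omega> X"
    unfolding compactly_supported_def using assms(3,4) evK moment_functions_le_0 by blast
  moreover have "X \<psi> \<in> K \<and> cmod (R (\<psi>, X \<psi>)) \<le> cmod (R (\<psi>, x))"
    if "\<psi> \<in> \<A> 0" "K \<subseteq> slice \<Omega> \<psi>" "x \<in> K" for \<psi> x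
    using X0(1)[OF that(1)] X0(2)[OF that] that(1) by (simp add: X_def)
  ultimately show ?thesis by (rule that)
qed

text \<open>Invertibility of the single value at the minimizing point bounds \<open>R\<close> from below on all of \<open>K\<close>. The
  bound is expressed by a moderate number \<open>s\<close>, namely twice the inverse of that value; the factor
  absorbs the negligible error, which is eventually below \<open>1/2\<close>.\<close>

lemma uniform_lower_bound:
  fixes \<Omega> :: "(real^'n::finite) set"
  assumes "open \<Omega>" "R \<in> E_M \<Omega>" "compact K" "K \<subseteq> \<Omega>"
    and inv: "\<And>X. X \<in> Omega_M \<Omega> \<Longrightarrow> compactly_supported \<Omega> X \<Longrightarrow>
      \<exists>s\<in>C_M. \<exists>i\<in>C_N. \<forall>\<psi>\<in>\<A> 0. eval_at \<Omega> R X \<psi> * s \<psi> = i \<psi> + 1"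
  obtains s :: "'n gnum" and q where "moderate_on {()} (\<lambda>\<psi> _. s \<psi>)"
    and "\<forall>\<phi>\<in>\<A> q. \<forall>\<^sub>F \<epsilon> in at_right 0. \<forall>x\<in>K. 1 \<le> cmod (s (scale \<epsilon> \<phi>)) * cmod (R (scale \<epsilon> \<phi>, x))"
proof (cases "K = {}")
  case True
  then show ?thesis using that[of "\<lambda>_. 0" 0] by (simp add: moderate_const)
next
  case False
  obtain X where X: "X \<in> Omega_M \<Omega>" "compactly_supported \<Omega> X"
    and min: "\<And>\<psi> x. \<psi> \<in> \<A> 0 \<Longrightarrow> K \<subseteq> slice \<Omega> \<psi> \<Longrightarrow> x \<in> K \<Longrightarrow>
      X \<psi> \<in> K \<and> cmod (R (\<psi>, X \<psi>)) \<le> cmod (R (\<psi>, x))"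
    using argmin_point[OF assms(1-4) False] by blast
  obtain s i where s: "s \<in> C_M" and i: "i \<in> C_N"
    and si: "\<forall>\<psi>\<in>\<A> 0. eval_at \<Omega> R X \<psi> * s \<psi> = i \<psi> + 1"
    using inv[OF X] by blast
  have "negligible_on {()} (\<lambda>\<psi> _. i \<psi>)" using i by (simp add: C_N_iff)
  then obtain q where q: "\<forall>\<phi>\<in>\<A> q. \<forall>\<^sub>F \<epsilon> in at_right 0. norm (i (scale \<epsilon> \<phi>)) < 1 / 2"
    using eventually_norm_less_of_negligible[of i "1 / 2"] by auto
  show ?thesis
  proof (rule that[of "\<lambda>\<psi>. 2 * s \<psi>" q])
    show "moderate_on {()} (\<lambda>\<psi> _. 2 * s \<psi>)"
      using s moderate_mult[OF moderate_const[of "{()}" 2], of "\<lambda>\<psi> _. s \<psi>"] by (simp add: C_M_iff)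
    show "\<forall>\<phi>\<in>\<A> q. \<forall>\<^sub>F \<epsilon> in at_right 0. \<forall>x\<in>K.
      1 \<le> cmod (2 * s (scale \<epsilon> \<phi>)) * cmod (R (scale \<epsilon> \<phi>, x))"
    proof
      fix \<phi> :: "real^'n \<Rightarrow> complex" assume \<phi>: "\<phi> \<in> \<A> q"
      note \<phi>0 = moment_functions_le_0[OF \<phi>]
      show "\<forall>\<^sub>F \<epsilon> in at_right 0. \<forall>x\<in>K. 1 \<le> cmod (2 * s (scale \<epsilon> \<phi>)) * cmod (R (scale \<epsilon> \<phi>, x))"
        using q[rule_format, OF \<phi>] eventually_scale_moment_functions[OF \<phi>0]
          eventually_subset_slice[OF assms(1,3,4) \<phi>0]
      proof eventually_elim
        case (elim \<epsilon>)
        let ?\<psi> = "scale \<epsilon> \<phi>"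
        show ?case
        proof
          fix x assume x: "x \<in> K"
          have "(?\<psi>, X ?\<psi>) \<in> U_set \<Omega>" using min[OF elim(2,3) x] elim(3) by (auto simp: slice_def)
          then have "R (?\<psi>, X ?\<psi>) * s ?\<psi> = i ?\<psi> + 1"
            using si[rule_format, OF elim(2)] elim(2) by (simp add: eval_at_def)
          moreover have "1 - cmod (i ?\<psi>) \<le> cmod (i ?\<psi> + 1)"
            using norm_triangle_ineq4[of "i ?\<psi> + 1" "i ?\<psi>"] by simp
          ultimately have "1 / 2 \<le> cmod (R (?\<psi>, X ?\<psi>)) * cmod (s ?\<psi>)"
            using elim(1) by (simp flip: norm_mult)
          also have "\<dots> \<le> cmod (R (?\<psi>, x)) * cmod (s ?\<psi>)"
            using min[OF elim(2,3) x] by (intro mult_right_mono) auto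
          finally show "1 \<le> cmod (2 * s ?\<psi>) * cmod (R (?\<psi>, x))" by (simp add: norm_mult algebra_simps)
        qed
      qed
    qed
  qed
qed

text \<open>Adding a positive term can only decrease the reciprocal of \<open>|F|\<^sup>2\<close>, which is at most \<open>|s|\<^sup>2\<close> wherever
  the lower bound holds.\<close>

lemma moderate_inverse_regularized:
  fixes F :: "'n::finite family"
  assumes "moderate_on {()} (\<lambda>\<psi> _. s \<psi>)"
    and "\<forall>\<phi>\<in>\<A> q. \<forall>\<^sub>F \<epsilon> in at_right 0. \<forall>x\<in>K. 1 \<le> cmod (s (scale \<epsilon> \<phi>)) * cmod (F (scale \<epsilon> \<phi>) x)"
  shows "moderate_on K (\<lambda>\<psi> x. inverse (F \<psi> x * cnj (F \<psi> x) + complex_of_real (flat \<psi>)))"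
proof (rule moderate_transfer[of "{()}" "\<lambda>\<psi> _. s \<psi> * s \<psi>" q])
  show "moderate_on {()} (\<lambda>\<psi> _. s \<psi> * s \<psi>)" using moderate_mult[OF assms(1) assms(1)] .
  show "\<forall>\<phi>\<in>\<A> q. \<forall>\<^sub>F \<epsilon> in at_right 0. \<forall>x\<in>K. \<exists>b\<in>{()}.
      cmod (inverse (F (scale \<epsilon> \<phi>) x * cnj (F (scale \<epsilon> \<phi>) x) + complex_of_real (flat (scale \<epsilon> \<phi>))))
        \<le> cmod (s (scale \<epsilon> \<phi>) * s (scale \<epsilon> \<phi>))"
  proof
    fix \<phi> :: "real^'n \<Rightarrow> complex" assume "\<phi> \<in> \<A> q"
    with assms(2) have "\<forall>\<^sub>F \<epsilon> in at_right 0. \<forall>x\<in>K. 1 \<le> cmod (s (scale \<epsilon> \<phi>)) * cmod (F (scale \<epsilon> \<phi>) x)" by blast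
    then show "\<forall>\<^sub>F \<epsilon> in at_right 0. \<forall>x\<in>K. \<exists>b\<in>{()}.
      cmod (inverse (F (scale \<epsilon> \<phi>) x * cnj (F (scale \<epsilon> \<phi>) x) + complex_of_real (flat (scale \<epsilon> \<phi>))))
        \<le> cmod (s (scale \<epsilon> \<phi>) * s (scale \<epsilon> \<phi>))"
    proof eventually_elim
      case (elim \<epsilon>)
      have "cmod (inverse (F (scale \<epsilon> \<phi>) x * cnj (F (scale \<epsilon> \<phi>) x) + complex_of_real (flat (scale \<epsilon> \<phi>))))
          \<le> cmod (s (scale \<epsilon> \<phi>) * s (scale \<epsilon> \<phi>))" if "x \<in> K" for x
      proof -
        define a where "a = cmod (s (scale \<epsilon> \<phi>))"
        define b where "b = cmod (F (scale \<epsilon> \<phi>) x)"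
        have pos: "flat (scale \<epsilon> \<phi>) > 0" by (simp add: flat_def)
        have ab: "1 \<le> a * b" using elim that by (simp add: a_def b_def)
        have "b > 0" using ab by (cases "b = 0") (auto simp: b_def)
        have "F (scale \<epsilon> \<phi>) x * cnj (F (scale \<epsilon> \<phi>) x) + complex_of_real (flat (scale \<epsilon> \<phi>))
            = complex_of_real (b\<^sup>2 + flat (scale \<epsilon> \<phi>))"
          by (simp only: b_def of_real_add complex_norm_square)
        then have "cmod (inverse (F (scale \<epsilon> \<phi>) x * cnj (F (scale \<epsilon> \<phi>) x) + complex_of_real (flat (scale \<epsilon> \<phi>))))
            = inverse (b\<^sup>2 + flat (scale \<epsilon> \<phi>))"
          using pos by (simp only: norm_inverse norm_of_real) (simp add: abs_of_nonneg)
        also have "\<dots> \<le> inverse (b\<^sup>2)" using pos \<open>b > 0\<close> by (intro le_imp_inverse_le) auto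
        also have "\<dots> \<le> a\<^sup>2"
        proof -
          have "1 \<le> (a * b)\<^sup>2" using ab by (simp add: one_le_power)
          then show ?thesis using \<open>b > 0\<close> by (simp add: power_mult_distrib field_simps)
        qed
        finally show ?thesis by (simp add: a_def norm_mult power2_eq_square)
      qed
      then show ?case by simp
    qed
  qed
qed

text \<open>The reciprocal of \<open>R\<close> need not exist: on a compact set \<open>R\<close> is bounded away from zero only for test
  functions with enough vanishing moments and for small \<open>\<epsilon>\<close>. The regularized inverse
  \<open>cnj R / (|R|\<^sup>2 + flat)\<close> is defined and smooth everywhere, and it differs from a true inverse by the
  factor \<open>1 - flat / (|R|\<^sup>2 + flat)\<close>, which is one up to a negligible function.\<close>

lemma E_M_inverse_modulo_N_e:
  fixes \<Omega> :: "(real^'n::finite) set"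
  assumes "open \<Omega>" "R \<in> E_M \<Omega>"
    and inv: "\<And>X. X \<in> Omega_M \<Omega> \<Longrightarrow> compactly_supported \<Omega> X \<Longrightarrow>
      \<exists>s\<in>C_M. \<exists>i\<in>C_N. \<forall>\<psi>\<in>\<A> 0. eval_at \<Omega> R X \<psi> * s \<psi> = i \<psi> + 1"
  shows "\<exists>S\<in>E_M \<Omega>. \<exists>J\<in>N_e \<Omega>. \<forall>p\<in>U_set \<Omega>. R p * S p = J p + 1"
proof -
  let ?F = "curry R"
  let ?Q = "\<lambda>\<psi> x. ?F \<psi> x * cnj (?F \<psi> x) + complex_of_real (flat \<psi>)"
  have F: "growth_family \<Omega> moderate_on ?F" using assms(2) by (simp add: E_M_iff[OF assms(1)])
  have cF: "growth_family \<Omega> moderate_on (\<lambda>\<psi> x. cnj (?F \<psi> x))"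
    using growth_family_cnj[OF assms(1) _ F] by simp
  have e: "growth_family \<Omega> negligible_on (\<lambda>\<psi> x. complex_of_real (flat \<psi>))"
    using growth_family_const[OF assms(1), of negligible_on "\<lambda>\<psi>. complex_of_real (flat \<psi>)"]
    by (simp add: negligible_flat)
  have Q: "growth_family \<Omega> moderate_on ?Q"
    using growth_family_add[OF assms(1) _ growth_family_mult[OF assms(1) _ F cF]
        negligible_family_imp_moderate_family[OF e]] by simp
  have Q_real: "?Q \<psi> x = complex_of_real ((cmod (?F \<psi> x))\<^sup>2 + flat \<psi>)" for \<psi> x
    by (simp only: of_real_add complex_norm_square)
  have Q_nz: "?Q \<psi> x \<noteq> 0" for \<psi> x
  proof -
    have "(cmod (?F \<psi> x))\<^sup>2 + flat \<psi> > 0" by (rule add_nonneg_pos) (simp_all add: flat_def)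
    then show ?thesis unfolding Q_real by (metis less_irrefl of_real_eq_0_iff)
  qed
  have Qi: "growth_family \<Omega> moderate_on (\<lambda>\<psi> x. inverse (?Q \<psi> x))"
  proof (rule moderate_family_inverse[OF assms(1) Q Q_nz])
    fix K assume K: "compact K" "K \<subseteq> \<Omega>"
    obtain s q where "moderate_on {()} (\<lambda>\<psi> _. s \<psi>)"
      "\<forall>\<phi>\<in>\<A> q. \<forall>\<^sub>F \<epsilon> in at_right 0. \<forall>x\<in>K. 1 \<le> cmod (s (scale \<epsilon> \<phi>)) * cmod (R (scale \<epsilon> \<phi>, x))"
      using uniform_lower_bound[OF assms(1,2) K inv] by blast
    then show "moderate_on K (\<lambda>\<psi> x. inverse (?Q \<psi> x))"
      by (intro moderate_inverse_regularized[of s q]) (simp_all add: curry_def)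
  qed
  have S: "growth_family \<Omega> moderate_on (\<lambda>\<psi> x. cnj (?F \<psi> x) * inverse (?Q \<psi> x))"
    using growth_family_mult[OF assms(1) _ cF Qi] by simp
  have J: "growth_family \<Omega> negligible_on (\<lambda>\<psi> x. complex_of_real (flat \<psi>) * (- 1 * inverse (?Q \<psi> x)))"
  proof -
    have m1: "growth_family \<Omega> moderate_on (\<lambda>\<psi> x. - 1)"
      using growth_family_const[OF assms(1), of moderate_on "\<lambda>\<psi>. - 1"] by (simp add: moderate_const)
    show ?thesis using growth_family_mult[OF assms(1) _ e growth_family_mult[OF assms(1) _ m1 Qi]] by simp
  qed
  have "?F \<psi> x * (cnj (?F \<psi> x) * inverse (?Q \<psi> x)) = complex_of_real (flat \<psi>) * (- 1 * inverse (?Q \<psi> x)) + 1"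
    for \<psi> x
  proof -
    have "?Q \<psi> x * inverse (?Q \<psi> x) = 1" using Q_nz by (rule right_inverse)
    then show ?thesis by (simp add: algebra_simps del: curry_conv)
  qed
  then show ?thesis
    using E_M_restrict[OF assms(1) S] N_e_restrict[OF assms(1) J]
    by (intro bexI[of _ "\<lambda>p\<in>U_set \<Omega>. cnj (?F (fst p) (snd p)) * inverse (?Q (fst p) (snd p))"]
        bexI[of _ "\<lambda>p\<in>U_set \<Omega>. complex_of_real (flat (fst p)) * (- 1 * inverse (?Q (fst p) (snd p)))"])
      (auto simp del: curry_conv simp: curry_conv[of R, symmetric])
qed

theorem proposition22:
  fixes \<Omega> :: "(real^'n::finite) set" and \<rho> :: "'n gfun set"
  assumes "open \<Omega>"
    and "\<rho> \<in> carrier (G_e \<Omega>)"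
  shows "\<rho> \<in> Units (G_e \<Omega>) \<longleftrightarrow>
    (\<forall>\<xi> \<in> gen_points_c \<Omega>. point_value \<Omega> \<rho> \<xi> \<in> Units gen_numbers)"
proof -
  let ?E = "pointwise_ring (U_set \<Omega>) (E_M \<Omega>)"
  interpret E: ideal "N_e \<Omega>" ?E by (rule ideal_N_e[OF assms(1)])
  interpret C: ideal "C_N :: 'n gnum set" C_M_ring by (rule ideal_C_N)
  obtain R where R: "R \<in> E_M \<Omega>" and \<rho>: "\<rho> = N_e \<Omega> +>\<^bsub>?E\<^esub> R"
    using assms(2) by (auto simp: G_e_def FactRing_def A_RCOSETS_def' pointwise_ring_def)
  have unit: "\<rho> \<in> Units (G_e \<Omega>) \<longleftrightarrow> (\<exists>S\<in>E_M \<Omega>. \<exists>J\<in>N_e \<Omega>. \<forall>p\<in>U_set \<Omega>. R p * S p = J p + 1)"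
  proof -
    have "\<rho> \<in> Units (G_e \<Omega>) \<longleftrightarrow>
        (\<exists>S\<in>carrier ?E. \<exists>J\<in>N_e \<Omega>. R \<otimes>\<^bsub>?E\<^esub> S = J \<oplus>\<^bsub>?E\<^esub> \<one>\<^bsub>?E\<^esub>)"
      unfolding \<rho> G_e_def using R
      by (intro E.coset_in_Units_Quot_iff[OF cring_E_M[OF assms(1)]]) (simp add: pointwise_ring_def)
    then show ?thesis by (simp add: pointwise_ring_def fun_eq_iff restrict_def Ball_def)
  qed
  have unit_value: "point_value \<Omega> \<rho> \<xi> \<in> Units gen_numbers \<longleftrightarrow>
      (\<exists>s\<in>C_M. \<exists>i\<in>C_N. \<forall>\<psi>\<in>\<A> 0. eval_at \<Omega> R X \<psi> * s \<psi> = i \<psi> + 1)"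
    if "\<xi> \<in> gen_points \<Omega>" "X \<in> \<xi>" "compactly_supported \<Omega> X" for \<xi> X
  proof -
    have "point_value \<Omega> \<rho> \<xi> \<in> Units gen_numbers \<longleftrightarrow>
        (\<exists>s\<in>carrier C_M_ring. \<exists>i\<in>C_N. eval_at \<Omega> R X \<otimes>\<^bsub>C_M_ring\<^esub> s = i \<oplus>\<^bsub>C_M_ring\<^esub> \<one>\<^bsub>C_M_ring\<^esub>)"
      unfolding \<rho> point_value_eq[OF assms(1) R that] gen_numbers_def
      using eval_at_C_M[OF assms(1) R that(3)]
      by (intro C.coset_in_Units_Quot_iff[OF cring_C_M]) (simp add: C_M_ring_def pointwise_ring_def)
    then show ?thesis by (simp add: C_M_ring_def pointwise_ring_def fun_eq_iff restrict_def Ball_def)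
  qed
  show ?thesis
  proof
    assume "\<rho> \<in> Units (G_e \<Omega>)"
    then obtain S J where S: "S \<in> E_M \<Omega>" and J: "J \<in> N_e \<Omega>"
      and RS: "\<forall>p\<in>U_set \<Omega>. R p * S p = J p + 1"
      unfolding unit by blast
    show "\<forall>\<xi> \<in> gen_points_c \<Omega>. point_value \<Omega> \<rho> \<xi> \<in> Units gen_numbers"
    proof
      fix \<xi> assume "\<xi> \<in> gen_points_c \<Omega>"
      then obtain X where \<xi>: "\<xi> \<in> gen_points \<Omega>" "X \<in> \<xi>" "compactly_supported \<Omega> X"
        by (auto simp: gen_points_c_def)
      have X: "X \<in> Omega_M \<Omega>" using gen_points_subset \<xi>(1,2) by blast
      \<comment> \<open>This is the value of \<open>J\<close> at \<open>X\<close> only for small \<open>\<epsilon>\<close>: while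
        \<open>(\<psi>, X \<psi>)\<close> lies outside the domain, all values are 0 and \<open>i \<psi> = -1\<close>.\<close>
      define i where "i = (\<lambda>\<psi>\<in>\<A> 0. eval_at \<Omega> R X \<psi> * eval_at \<Omega> S X \<psi> - 1)"
      have J0: "negligible_on {()} (\<lambda>\<psi> _. eval_at \<Omega> J X \<psi>)"
        using eval_at_C_N[OF assms(1) J \<xi>(3)] by (simp add: C_N_iff)
      have "negligible_on {()} (\<lambda>\<psi> _. eval_at \<Omega> R X \<psi> * eval_at \<Omega> S X \<psi> - 1)"
      proof (rule negligible_transfer[OF J0, of 0], rule ballI)
        fix \<phi> :: "real^'n \<Rightarrow> complex" assume "\<phi> \<in> \<A> 0"
        from eventually_in_U_set[OF X this]
        show "\<forall>\<^sub>F \<epsilon> in at_right 0. \<forall>b\<in>{()}. \<exists>b'\<in>{()}.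
          cmod (eval_at \<Omega> R X (scale \<epsilon> \<phi>) * eval_at \<Omega> S X (scale \<epsilon> \<phi>) - 1)
            \<le> cmod (eval_at \<Omega> J X (scale \<epsilon> \<phi>))"
          by eventually_elim (use RS in \<open>auto simp: eval_at_def\<close>)
      qed
      then have "i \<in> C_N" unfolding i_def by (rule C_N_restrict)
      moreover have "eval_at \<Omega> S X \<in> C_M" by (rule eval_at_C_M[OF assms(1) S \<xi>(3)])
      ultimately show "point_value \<Omega> \<rho> \<xi> \<in> Units gen_numbers"
        unfolding unit_value[OF \<xi>] by (intro bexI[of _ "eval_at \<Omega> S X"] bexI[of _ i]) (auto simp: i_def)
    qed
  next
    assume units: "\<forall>\<xi> \<in> gen_points_c \<Omega>. point_value \<Omega> \<rho> \<xi> \<in> Units gen_numbers"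
    show "\<rho> \<in> Units (G_e \<Omega>)"
      unfolding unit
    proof (rule E_M_inverse_modulo_N_e[OF assms(1) R])
      fix X assume X: "X \<in> Omega_M \<Omega>" "compactly_supported \<Omega> X"
      note \<xi> = point_class[OF X(1)]
      have "point_equiv \<Omega> `` {X} \<in> gen_points_c \<Omega>" using \<xi> X(2) by (auto simp: gen_points_c_def)
      with units have "point_value \<Omega> \<rho> (point_equiv \<Omega> `` {X}) \<in> Units gen_numbers" by blast
      then show "\<exists>s\<in>C_M. \<exists>i\<in>C_N. \<forall>\<psi>\<in>\<A> 0. eval_at \<Omega> R X \<psi> * s \<psi> = i \<psi> + 1"
        unfolding unit_value[OF \<xi> X(2)] .
    qed
  qed
qed

end
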